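(* Let $\mathscr{A}$ be a unital $C^*$-algebra equipped with a $*$-conjugate-automorphism $\sharp$, let $\mathscr{E}$ be a right Hilbert $\mathscr{A}$-module, let $C$ be a $\sharp$-conjugation on $\mathscr{E}$, and let $T,S\in\mathbb{L}(\mathscr{E})$ be such that $\overline{\operatorname{ran}(T)}$ is orthogonally complemented. Then the following assertions are equivalent. (i) $T^*T\geq CS^*SC$. (ii) $\|Tx\|\geq\|SCx\|$ for every $x\in\mathscr{E}$.
   Context: A $*$-conjugate-automorphism on a $C^*$-algebra $\mathscr{A}$ is a map $\sharp:\mathscr{A}\to\mathscr{A}$, $a\mapsto a^\sharp$, such that for all $a,b\in\mathscr{A}$, $\lambda\in\mathbb{C}$: (1) $(\lambda a+b)^\sharp=\bar\lambda a^\sharp+b^\sharp$; (2) $(a^\sharp)^\sharp=a$; (3) $(a^\sharp)^*=(a^* )^\sharp$; (4) $(ab)^\sharp=a^\sharp b^\sharp$. $\mathbb{L}(\mathscr{E})$ is the $C^*$-algebra of adjointable linear operators on $\mathscr{E}$ (inner products are conjugate-linear in the first variable). A $\sharp$-conjugation on $\mathscr{E}$ is a bounded conjugate-linear operator $C:\mathscr{E}\to\mathscr{E}$ with $C^2=I_{\mathscr{E}}$ and $\langle Cx,Cy\rangle=\langle x,y\rangle^\sharp$ for all $x,y\in\mathscr{E}$. A closed submodule $M$ is orthogonally complemented if $\mathscr{E}=M\oplus M^\perp$. *)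

theory Defs
  imports "HOL-Analysis.Analysis" "HOL-Library.Nonpos_Ints"
begin

text \<open>
  Complex vector spaces are built on the real type classes, so that norms, closures and
  completeness are those of the library; the complex scaling extends the real one.
\<close>

class complex_vector = real_vector +
  fixes scaleC :: "complex \<Rightarrow> 'a \<Rightarrow> 'a"  (infixr "*\<^sub>C" 75)
  assumes scaleC_add_right: "c *\<^sub>C (x + y) = c *\<^sub>C x + c *\<^sub>C y"
    and scaleC_add_left: "(c + d) *\<^sub>C x = c *\<^sub>C x + d *\<^sub>C x"
    and scaleC_scaleC: "c *\<^sub>C d *\<^sub>C x = (c * d) *\<^sub>C x"
    and scaleR_scaleC: "r *\<^sub>R x = complex_of_real r *\<^sub>C x"

class complex_normed_vector = complex_vector + real_normed_vector +
  assumes norm_scaleC: "norm (c *\<^sub>C x) = cmod c * norm x"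

text \<open>
  Unital C*-algebras. The unit comes from \<^class>\<open>monoid_mult\<close> rather than from
  \<^class>\<open>real_normed_algebra_1\<close>, so the zero algebra is not excluded; in every other case
  \<open>norm 1 = 1\<close> follows from the C*-identity.
\<close>

class cstar_algebra = real_normed_algebra + monoid_mult + complex_normed_vector + banach +
  fixes star :: "'a \<Rightarrow> 'a"
  assumes mult_scaleC_left: "(c *\<^sub>C a) * b = c *\<^sub>C (a * b)"
    and mult_scaleC_right: "a * (c *\<^sub>C b) = c *\<^sub>C (a * b)"
    and star_add: "star (a + b) = star a + star b"
    and star_scaleC: "star (c *\<^sub>C a) = cnj c *\<^sub>C star a"
    and star_mult: "star (a * b) = star b * star a"
    and star_star: "star (star a) = a"
    and norm_star_mult: "norm (star a * a) = (norm a)\<^sup>2"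

definition cstar_spectrum :: "'a::cstar_algebra \<Rightarrow> complex set" where
  "cstar_spectrum a =
     {z. \<not> (\<exists>b. b * (z *\<^sub>C 1 - a) = 1 \<and> (z *\<^sub>C 1 - a) * b = 1)}"

definition cstar_positive :: "'a::cstar_algebra \<Rightarrow> bool" where
  "cstar_positive a \<longleftrightarrow> star a = a \<and> cstar_spectrum a \<subseteq> \<real>\<^sub>\<ge>\<^sub>0"

definition star_conj_automorphism :: "('a::cstar_algebra \<Rightarrow> 'a) \<Rightarrow> bool" where
  "star_conj_automorphism sharp \<longleftrightarrow>
     (\<forall>c a b. sharp (c *\<^sub>C a + b) = cnj c *\<^sub>C sharp a + sharp b) \<and>
     (\<forall>a. sharp (sharp a) = a) \<and>
     (\<forall>a. star (sharp a) = sharp (star a)) \<and>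
     (\<forall>a b. sharp (a * b) = sharp a * sharp b)"

text \<open>
  Right Hilbert modules. The module is a whole type, complete for its norm by
  \<^class>\<open>banach\<close>; \<open>norm_eq\<close> says that this norm is the one induced by the
  algebra-valued inner product, which is linear in the second variable.
\<close>

locale hilbert_module =
  fixes act :: "'e::{complex_normed_vector, banach} \<Rightarrow> 'a::cstar_algebra \<Rightarrow> 'e"
    and ip :: "'e \<Rightarrow> 'e \<Rightarrow> 'a"
  assumes act_add_left: "act (x + y) a = act x a + act y a"
    and act_add_right: "act x (a + b) = act x a + act x b"
    and act_mult: "act x (a * b) = act (act x a) b"
    and act_one: "act x 1 = x"
    and act_scaleC_left: "act (c *\<^sub>C x) a = c *\<^sub>C act x a"
    and act_scaleC_right: "act x (c *\<^sub>C a) = c *\<^sub>C act x a"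
    and ip_add_right: "ip x (y + z) = ip x y + ip x z"
    and ip_scaleC_right: "ip x (c *\<^sub>C y) = c *\<^sub>C ip x y"
    and ip_act_right: "ip x (act y a) = ip x y * a"
    and ip_star: "star (ip x y) = ip y x"
    and ip_positive: "cstar_positive (ip x x)"
    and ip_definite: "ip x x = 0 \<Longrightarrow> x = 0"
    and norm_eq: "norm x = sqrt (norm (ip x x))"

definition adjointable_ops ::
  "('e::complex_normed_vector \<Rightarrow> 'e \<Rightarrow> 'a::cstar_algebra) \<Rightarrow> ('e \<Rightarrow> 'e) set" where
  "adjointable_ops ip =
     {T. (\<forall>c x y. T (c *\<^sub>C x + y) = c *\<^sub>C T x + T y) \<and>
         (\<exists>T'. \<forall>x y. ip (T x) y = ip x (T' y))}"

definition adj ::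
  "('e::complex_normed_vector \<Rightarrow> 'e \<Rightarrow> 'a::cstar_algebra) \<Rightarrow> ('e \<Rightarrow> 'e) \<Rightarrow> 'e \<Rightarrow> 'e" where
  "adj ip T = (THE T'. \<forall>x y. ip (T x) y = ip x (T' y))"

text \<open>
  Spectrum and positivity in the C*-algebra \<^term>\<open>adjointable_ops ip\<close>, whose product is
  composition: as for \<^const>\<open>cstar_spectrum\<close>, the inverse is sought in the algebra itself.
\<close>

definition op_spectrum ::
  "('e::complex_normed_vector \<Rightarrow> 'e \<Rightarrow> 'a::cstar_algebra) \<Rightarrow> ('e \<Rightarrow> 'e) \<Rightarrow> complex set" where
  "op_spectrum ip T =
     {z. \<not> (\<exists>R\<in>adjointable_ops ip.
            R \<circ> (\<lambda>x. z *\<^sub>C x - T x) = id \<and> (\<lambda>x. z *\<^sub>C x - T x) \<circ> R = id)}"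

definition op_positive ::
  "('e::complex_normed_vector \<Rightarrow> 'e \<Rightarrow> 'a::cstar_algebra) \<Rightarrow> ('e \<Rightarrow> 'e) \<Rightarrow> bool" where
  "op_positive ip T \<longleftrightarrow>
     T \<in> adjointable_ops ip \<and> adj ip T = T \<and> op_spectrum ip T \<subseteq> \<real>\<^sub>\<ge>\<^sub>0"

definition op_le ::
  "('e::complex_normed_vector \<Rightarrow> 'e \<Rightarrow> 'a::cstar_algebra) \<Rightarrow> ('e \<Rightarrow> 'e) \<Rightarrow> ('e \<Rightarrow> 'e) \<Rightarrow> bool" where
  "op_le ip S T \<longleftrightarrow> op_positive ip (\<lambda>x. T x - S x)"

text \<open>
  \<^const>\<open>bounded_linear\<close> is boundedness and real linearity; the second conjunct makes the
  operator conjugate-linear.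
\<close>

definition sharp_conjugation ::
  "('e::complex_normed_vector \<Rightarrow> 'e \<Rightarrow> 'a::cstar_algebra) \<Rightarrow> ('a \<Rightarrow> 'a) \<Rightarrow> ('e \<Rightarrow> 'e) \<Rightarrow> bool" where
  "sharp_conjugation ip sharp C \<longleftrightarrow>
     bounded_linear C \<and>
     (\<forall>c x. C (c *\<^sub>C x) = cnj c *\<^sub>C C x) \<and>
     C \<circ> C = id \<and>
     (\<forall>x y. ip (C x) (C y) = sharp (ip x y))"

definition orth_compl ::
  "('e::complex_normed_vector \<Rightarrow> 'e \<Rightarrow> 'a::cstar_algebra) \<Rightarrow> 'e set \<Rightarrow> 'e set" where
  "orth_compl ip M = {y. \<forall>x\<in>M. ip x y = 0}"

definition orthogonally_complemented ::
  "('e::complex_normed_vector \<Rightarrow> 'e \<Rightarrow> 'a::cstar_algebra) \<Rightarrow> 'e set \<Rightarrow> bool" where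
  "orthogonally_complemented ip M \<longleftrightarrow>
     (\<forall>z. \<exists>x\<in>M. \<exists>y\<in>orth_compl ip M. z = x + y) \<and> M \<inter> orth_compl ip M = {0}"

end

theory Submission
  imports Defs
begin

text \<open>
  Put \<open>V = C S C\<close>, which is adjointable with adjoint \<open>C S\<^sup>* C\<close>; since \<open>C\<close> is isometric, the claim is that
  \<open>V\<^sup>* V \<le> T\<^sup>* T\<close> iff \<open>\<parallel>V x\<parallel> \<le> \<parallel>T x\<parallel>\<close> for all \<open>x\<close>. Positivity of an operator amounts to nonnegativity of
  its algebra-valued form, so the norm inequality is necessary. Conversely, apply it to \<open>x h\<close> with
  \<open>h = (\<langle>T x, T x\<rangle> + \<epsilon>)\<^sup>-\<^sup>1\<^sup>/\<^sup>2\<close>: it gives \<open>h \<langle>V x, V x\<rangle> h \<le> 1\<close>, whence \<open>\<langle>V x, V x\<rangle> \<le> \<langle>T x, T x\<rangle> + \<epsilon>\<close>.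
\<close>

section \<open>Positive elements of a C*-algebra\<close>

text \<open>Positivity is defined by spectra, both in the algebra and in L(E), whereas the claim
  compares norms and forms. For a self-adjoint a with norm a <= t, positivity means norm (t - a) <=
  t, which turns the spectral condition into a convex one; the square roots behind this come from an
  iteration. Adjointable operators form a set of functions and not an instance of
  \<open>cstar_algebra\<close>, so the algebra lemmas are applied only to values of the inner
  product, and the spectrum of an operator is reached through the invertibility of maps with
  coercive form. The norm inequality sees one number per vector; it yields an inequality in the
  algebra because it also holds at all multiples x h. The epsilon is there because <T x, T x> need
  not be invertible.\<close>

lemma scaleC_zero_left [simp]: "0 *\<^sub>C (x::'a::complex_vector) = 0"
  using scaleR_scaleC[of 0 x] by simp

lemma scaleC_one [simp]: "1 *\<^sub>C (x::'a::complex_vector) = x"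
  using scaleR_scaleC[of 1 x] by simp

lemma scaleC_zero_right [simp]: "c *\<^sub>C (0::'a::complex_vector) = 0"
  using scaleC_add_right[of c "0::'a" 0] by simp

lemma scaleC_minus_right: "c *\<^sub>C (- x::'a::complex_vector) = - (c *\<^sub>C x)"
  using scaleC_add_right[of c x "-x"] by (simp add: eq_neg_iff_add_eq_0 add.commute)

lemma scaleC_minus_left: "(- c) *\<^sub>C (x::'a::complex_vector) = - (c *\<^sub>C x)"
  using scaleC_add_left[of c "-c" x] by (simp add: eq_neg_iff_add_eq_0 add.commute)

lemma scaleC_diff_right: "c *\<^sub>C (x - y::'a::complex_vector) = c *\<^sub>C x - c *\<^sub>C y"
  using scaleC_add_right[of c x "-y"] by (simp add: scaleC_minus_right)

lemma scaleC_diff_left: "(c - d) *\<^sub>C (x::'a::complex_vector) = c *\<^sub>C x - d *\<^sub>C x"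
  using scaleC_add_left[of c "-d" x] by (simp add: scaleC_minus_left)

lemma star_zero [simp]: "star (0::'a::cstar_algebra) = 0"
  using star_add[of "0::'a" 0] by simp

lemma star_minus: "star (- a::'a::cstar_algebra) = - star a"
  using star_add[of a "-a"] by (simp add: eq_neg_iff_add_eq_0 add.commute)

lemma star_diff: "star (a - b::'a::cstar_algebra) = star a - star b"
  using star_add[of a "-b"] by (simp add: star_minus)

lemma star_one [simp]: "star (1::'a::cstar_algebra) = 1"
  using star_mult[of "star 1" "1::'a"] by (simp add: star_star)

lemma star_scaleR: "star (r *\<^sub>R a::'a::cstar_algebra) = r *\<^sub>R star a"
  by (simp add: scaleR_scaleC star_scaleC)

lemmas star_simps = star_add star_minus star_diff star_scaleR star_mult star_star

lemma norm_star: "norm (star a::'a::cstar_algebra) = norm a"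
proof -
  have *: "norm a \<le> norm (star a)" for a :: 'a
  proof (cases "a = 0")
    case False
    have "norm a * norm a \<le> norm (star a) * norm a"
      using norm_mult_ineq[of "star a" a] by (simp add: norm_star_mult power2_eq_square)
    then show ?thesis using False by simp
  qed simp
  show ?thesis using *[of a] *[of "star a"] by (simp add: star_star)
qed

lemma bounded_linear_star: "bounded_linear (star :: 'a::cstar_algebra \<Rightarrow> 'a)"
  by (rule bounded_linear_intro[where K=1]) (simp_all add: star_simps norm_star)

lemma norm_selfadjoint_square:
  "star a = (a::'a::cstar_algebra) \<Longrightarrow> norm (a * a) = (norm a)\<^sup>2"
  using norm_star_mult[of a] by simp

lemma square_eq_zero_selfadjoint:
  "star a = (a::'a::cstar_algebra) \<Longrightarrow> a * a = 0 \<Longrightarrow> a = 0"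
  using norm_selfadjoint_square[of a] by simp

text \<open>The C*-identity makes \<open>norm 1\<close> equal to its own square; the value 0 leaves
  only the zero algebra, which the class admits.\<close>

lemma norm_one_cases: "norm (1::'a::cstar_algebra) = 1 \<or> (\<forall>a::'a. a = 0)"
proof -
  have "norm (1::'a) = (norm (1::'a))\<^sup>2" using norm_selfadjoint_square[of "1::'a"] by simp
  then have "norm (1::'a) = 1 \<or> norm (1::'a) = 0" unfolding power2_eq_square by (metis mult_cancel_left1)
  moreover have "a = 0" if "(1::'a) = 0" for a :: 'a
    using that mult_1_left[of a] mult_zero_left[of a] by simp
  ultimately show ?thesis by auto
qed

lemma norm_one_le: "norm (1::'a::cstar_algebra) \<le> 1"
  using norm_one_cases[where 'a='a]
proof
  assume "\<forall>a::'a. a = 0"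
  then have "(1::'a) = 0" by blast
  then show ?thesis by simp
qed simp

section \<open>Invertible elements\<close>

definition unit_elt :: "'a::cstar_algebra \<Rightarrow> bool" where
  "unit_elt a \<longleftrightarrow> (\<exists>b. b * a = 1 \<and> a * b = 1)"

lemma unit_eltI: "b * a = 1 \<Longrightarrow> a * c = 1 \<Longrightarrow> unit_elt (a::'a::cstar_algebra)"
proof -
  assume b: "b * a = 1" and c: "a * c = 1"
  have "b * (a * c) = c" using b by (simp flip: mult.assoc)
  then have "b = c" using c by simp
  then show "unit_elt a" using b c unfolding unit_elt_def by blast
qed

lemma not_in_cstar_spectrum: "z \<notin> cstar_spectrum a \<longleftrightarrow> unit_elt (z *\<^sub>C 1 - a)"
  by (simp add: cstar_spectrum_def unit_elt_def)

lemma in_cstar_spectrum: "z \<in> cstar_spectrum a \<longleftrightarrow> \<not> unit_elt (z *\<^sub>C 1 - a)"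
  by (simp add: cstar_spectrum_def unit_elt_def)

lemma unit_elt_mult: "unit_elt a \<Longrightarrow> unit_elt b \<Longrightarrow> unit_elt (a * b::'a::cstar_algebra)"
proof -
  assume "unit_elt a" "unit_elt b"
  then obtain c d where c: "c * a = 1" "a * c = 1" and d: "d * b = 1" "b * d = 1"
    unfolding unit_elt_def by blast
  have "(d * c) * (a * b) = d * ((c * a) * b)" "(a * b) * (d * c) = a * ((b * d) * c)"
    by (simp_all only: mult.assoc)
  then show "unit_elt (a * b)" unfolding unit_elt_def using c d by auto
qed

lemma unit_elt_factor:
  assumes "unit_elt (a * b)" "a * b = b * a" shows "unit_elt (a::'a::cstar_algebra)"
proof -
  obtain c where c: "c * (a * b) = 1" "(a * b) * c = 1" using assms(1) unfolding unit_elt_def by blast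
  have "(c * b) * a = 1" using c(1) by (simp only: assms(2) mult.assoc)
  moreover have "a * (b * c) = 1" using c(2) by (simp only: mult.assoc)
  ultimately show ?thesis by (rule unit_eltI)
qed

lemma unit_elt_scaleC:
  assumes "c \<noteq> 0" shows "unit_elt (c *\<^sub>C a) \<longleftrightarrow> unit_elt (a::'a::cstar_algebra)"
proof -
  have *: "unit_elt (c *\<^sub>C a)" if c: "c \<noteq> 0" and u: "unit_elt a" for c and a :: 'a
  proof -
    obtain b where "b * a = 1" "a * b = 1" using u unfolding unit_elt_def by blast
    then show ?thesis using c
      by (intro unit_eltI[of "inverse c *\<^sub>C b" _ "inverse c *\<^sub>C b"])
        (simp_all add: mult_scaleC_left mult_scaleC_right scaleC_scaleC)
  qed
  have "inverse c *\<^sub>C c *\<^sub>C a = a" using assms by (simp add: scaleC_scaleC)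
  then show ?thesis using *[of c a] *[of "inverse c" "c *\<^sub>C a"] assms
    by (metis inverse_nonzero_iff_nonzero)
qed

lemma unit_elt_minus: "unit_elt (- a) \<longleftrightarrow> unit_elt (a::'a::cstar_algebra)"
  using unit_elt_scaleC[of "-1" a] by (simp add: scaleC_minus_left)

lemma contraction_fixpoint:
  fixes f :: "'a::banach \<Rightarrow> 'a"
  assumes "q < 1" and "\<And>x y. norm (f x - f y) \<le> q * norm (x - y)"
  shows "\<exists>!x. f x = x"
proof -
  have "norm (f x - f y) \<le> max q 0 * norm (x - y)" for x y
    using assms(2)[of x y] mult_right_mono[of q "max q 0" "norm (x - y)"] by simp
  then show ?thesis
    using banach_fix_type[of "max q 0" f] assms(1) by (simp add: dist_norm)
qed

text \<open>Banach's fixed point theorem replaces the Neumann series: the fixed points of x = 1 + a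
  x and y = 1 + y a are a right and a left inverse, which \<open>unit_eltI\<close>
  identifies.\<close>

lemma unit_elt_one_minus:
  assumes "norm (a::'a::cstar_algebra) < 1" shows "unit_elt (1 - a)"
proof -
  have "\<exists>!x. 1 + a * x = x"
    using assms norm_mult_ineq[of a] by (intro contraction_fixpoint[of "norm a"])
      (simp_all flip: right_diff_distrib)
  moreover have "\<exists>!x. 1 + x * a = x"
    using assms norm_mult_ineq[of _ a] by (intro contraction_fixpoint[of "norm a"])
      (simp_all add: mult.commute[of "norm a"] flip: left_diff_distrib)
  ultimately obtain x y where "1 + a * x = x" "1 + y * a = y" by blast
  then show ?thesis
    by (intro unit_eltI[of y _ x]) (simp_all add: algebra_simps eq_diff_eq)
qed

lemma unit_elt_diff:
  assumes "norm (a::'a::cstar_algebra) < cmod z" shows "unit_elt (z *\<^sub>C 1 - a)"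
proof -
  have z: "z \<noteq> 0" using assms norm_ge_zero[of a] by (auto simp del: norm_ge_zero)
  have "norm (inverse z *\<^sub>C a) < 1" using assms z
    by (simp add: norm_scaleC norm_inverse norm_divide field_simps)
  then have "unit_elt (z *\<^sub>C (1 - inverse z *\<^sub>C a))"
    using unit_elt_one_minus unit_elt_scaleC z by blast
  then show ?thesis using z by (simp add: scaleC_diff_right scaleC_scaleC)
qed

text \<open>The left side is \<open>\<parallel>u + iv\<parallel>\<^sup>2\<close>, and \<open>u\<close> is the real part of \<open>u + iv\<close>.\<close>

lemma norm_square_le_add_square:
  fixes u v :: "'a::cstar_algebra"
  assumes u: "star u = u" and v: "star v = v" and "u * v = v * u"
  shows "norm (u * u) \<le> norm (u * u + v * v)"
proof -
  define w where "w = u + \<i> *\<^sub>C v"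
  have sw: "star w = u - \<i> *\<^sub>C v"
    by (simp add: w_def star_add star_scaleC u v scaleC_minus_left)
  have "star w * w = u * u + v * v"
    unfolding sw using assms(3)
    by (simp add: w_def algebra_simps mult_scaleC_left mult_scaleC_right scaleC_add_right scaleC_diff_right
        scaleC_scaleC scaleC_minus_left)
  then have n: "norm (u * u + v * v) = (norm w)\<^sup>2" by (metis norm_star_mult)
  have "w + star w = 2 *\<^sub>R u" unfolding sw by (simp add: w_def scaleR_2)
  then have "2 * norm u = norm (w + star w)" by simp
  also have "\<dots> \<le> 2 * norm w" using norm_triangle_ineq[of w "star w"] by (simp add: norm_star)
  finally show ?thesis using n by (simp add: norm_selfadjoint_square[OF u])
qed

section \<open>Square roots by iteration\<close>

lemma majorant_sequence:
  obtains u :: "nat \<Rightarrow> real"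
  where "u 0 = 0" "\<And>n. u (Suc n) = (1 + (u n)\<^sup>2) / 2" "\<And>n. 0 \<le> u n" "\<And>n. u n \<le> 1" "Cauchy u"
proof
  define u :: "nat \<Rightarrow> real" where "u = rec_nat 0 (\<lambda>_ x. (1 + x\<^sup>2) / 2)"
  show z: "u 0 = 0" and s: "u (Suc n) = (1 + (u n)\<^sup>2) / 2" for n by (simp_all add: u_def)
  show nn: "0 \<le> u n" for n by (cases n) (auto simp: z s)
  show le: "u n \<le> 1" for n
  proof (induction n)
    case (Suc n)
    then show ?case using nn[of n] by (simp add: s power_le_one)
  qed (simp add: z)
  have "u n \<le> u (Suc n)" for n
    using zero_le_power2[of "u n - 1"] by (simp add: s power2_eq_square algebra_simps)
  then have "incseq u" by (rule incseq_SucI)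
  then have "convergent u" using le incseq_convergent[of u 1] unfolding convergent_def by metis
  then show "Cauchy u" by (rule convergent_Cauchy)
qed

text \<open>Solves \<open>y = (p + y\<^sup>2) / 2\<close> by iteration from \<open>0\<close>; the increments are dominated by those of the
  scalar iteration for \<open>p = 1\<close>, which increases to \<open>1\<close>.\<close>

lemma sqrt_one_minus:
  fixes p :: "'a::cstar_algebra"
  assumes p: "star p = p" "norm p \<le> 1"
  obtains y where "star y = y" "norm y \<le> 1" "(1 - y) * (1 - y) = 1 - p"
    "\<And>z. z * p = p * z \<Longrightarrow> z * y = y * z"
proof -
  obtain u :: "nat \<Rightarrow> real" where u0: "u 0 = 0" and us: "\<And>n. u (Suc n) = (1 + (u n)\<^sup>2) / 2"
    and un: "\<And>n. 0 \<le> u n" and ul: "\<And>n. u n \<le> 1" and uC: "Cauchy u"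
    by (rule majorant_sequence) blast
  \<comment> \<open>When norm p = 1 this map need not be a strict contraction on the unit ball, so
    \<open>contraction_fixpoint\<close> is out of reach and the majorant \<open>u\<close> takes its
    place.\<close>
  define y where "y = rec_nat 0 (\<lambda>_ x. (1/2) *\<^sub>R (p + x * x))"
  have y0: "y 0 = 0" and ys: "y (Suc n) = (1/2) *\<^sub>R (p + y n * y n)" for n
    by (simp_all add: y_def)
  have yn: "norm (y n) \<le> u n" for n
  proof (induction n)
    case (Suc n)
    have "norm (y n * y n) \<le> u n * u n"
      using norm_mult_ineq[of "y n" "y n"] mult_mono[OF Suc Suc un norm_ge_zero] by linarith
    then show ?case
      using norm_triangle_ineq[of p "y n * y n"] p(2) by (simp add: ys us power2_eq_square)
  qed (simp add: y0 u0)
  have yd: "norm (y (Suc n) - y n) \<le> u (Suc n) - u n" for n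
  proof (induction n)
    case 0
    show ?case using p(2) by (simp add: ys us y0 u0)
  next
    case (Suc n)
    let ?s = "y (Suc n) + y n" and ?d = "y (Suc n) - y n"
    \<comment> \<open>The symmetrised form of a difference of squares, (s d + d s) / 2, holds
      without commutation of the iterates.\<close>
    have e: "y (Suc (Suc n)) - y (Suc n) = (1/4) *\<^sub>R (?s * ?d + ?d * ?s)"
      unfolding ys[of "Suc n"] ys[of n, symmetric]
      by (subst (3) ys) (simp add: algebra_simps flip: scaleR_add_left)
    have s: "norm ?s \<le> u (Suc n) + u n"
      using norm_triangle_ineq[of "y (Suc n)" "y n"] yn[of n] yn[of "Suc n"] by linarith
    have "norm (?s * ?d) \<le> (u (Suc n) + u n) * (u (Suc n) - u n)"
      by (rule order_trans[OF norm_mult_ineq])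
        (rule mult_mono[OF s Suc]; use un[of n] un[of "Suc n"] in simp)
    moreover have "norm (?d * ?s) \<le> (u (Suc n) - u n) * (u (Suc n) + u n)"
      by (rule order_trans[OF norm_mult_ineq])
        (rule mult_mono[OF Suc s]; use order_trans[OF norm_ge_zero Suc] in simp)
    ultimately have "norm (?s * ?d + ?d * ?s) \<le> 2 * ((u (Suc n))\<^sup>2 - (u n)\<^sup>2)"
      using norm_triangle_ineq[of "?s * ?d" "?d * ?s"]
      by (simp add: power2_eq_square algebra_simps)
    then show ?case unfolding e norm_scaleR us[of "Suc n"] us[of n] by (simp add: field_simps)
  qed
  have "norm (y (n + k) - y n) \<le> u (n + k) - u n" for n k
  proof (induction k)
    case (Suc k)
    then show ?case using yd[of "n + k"] norm_triangle_ineq[of "y (Suc (n+k)) - y (n+k)" "y (n + k) - y n"] by simp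
  qed simp
  then have yd': "norm (y m - y n) \<le> \<bar>u m - u n\<bar>" if "n \<le> m" for m n
    using \<open>norm (y (n + (m - n)) - y n) \<le> u (n + (m - n)) - u n\<close> that by simp
  have "norm (y m - y n) \<le> \<bar>u m - u n\<bar>" for m n
    using yd'[of m n] yd'[of n m] linear[of m n] by (auto simp: norm_minus_commute abs_minus_commute)
  note du = this
  have "Cauchy y" unfolding Cauchy_iff
  proof (intro allI impI)
    fix e :: real assume "e > 0"
    then obtain N where N: "\<forall>m\<ge>N. \<forall>n\<ge>N. norm (u m - u n) < e"
      using uC unfolding Cauchy_iff by metis
    have "norm (y m - y n) < e" if "m \<ge> N" "n \<ge> N" for m n
      using N that du[of m n] by fastforce
    then show "\<exists>M. \<forall>m\<ge>M. \<forall>n\<ge>M. norm (y m - y n) < e" by blast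
  qed
  then obtain l where l: "y \<longlonglongrightarrow> l" unfolding Cauchy_convergent_iff convergent_def ..
  show thesis
  proof
    have "star (y n) = y n" for n by (induction n) (simp_all add: y0 ys star_simps p)
    then have "y \<longlonglongrightarrow> star l" using bounded_linear.tendsto[OF bounded_linear_star l] by simp
    then show "star l = l" using l LIMSEQ_unique by blast
    show "norm l \<le> 1" using yn ul by (intro Lim_norm_ubound[OF _ l] always_eventually)
        (auto intro: order_trans)
    have "(\<lambda>n. y (Suc n)) \<longlonglongrightarrow> (1/2) *\<^sub>R (p + l * l)" unfolding ys by (intro tendsto_intros l)
    then have "l = (1/2) *\<^sub>R (p + l * l)" using LIMSEQ_unique LIMSEQ_Suc[OF l] by blast
    from arg_cong[OF this, of "scaleR 2"] have "2 *\<^sub>R l = p + l * l" by simp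
    then show "(1 - l) * (1 - l) = 1 - p" by (simp add: algebra_simps scaleR_2)
    fix z assume z: "z * p = p * z"
    have "z * y n = y n * z" for n
    proof (induction n)
      case (Suc n)
      then have "z * (y n * y n) = y n * y n * z" by (metis mult.assoc)
      then show ?case by (simp add: ys z algebra_simps)
    qed (simp add: y0)
    moreover have "(\<lambda>n. z * y n) \<longlonglongrightarrow> z * l" "(\<lambda>n. y n * z) \<longlonglongrightarrow> l * z" by (intro tendsto_intros l)+
    ultimately show "z * l = l * z" using LIMSEQ_unique by simp
  qed
qed

text \<open>The root keeps the shape \<open>s *\<^sub>R 1 - y\<close> with
  \<open>norm y \<le> s\<close> because this is what \<open>positive_scalar_minus\<close> later
  recognises as positive.\<close>

lemma sqrt_scalar_minus:
  fixes p :: "'a::cstar_algebra"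
  assumes p: "star p = p" "norm p \<le> t"
  obtains s y where "star y = y" "norm y \<le> s" "(s *\<^sub>R 1 - y) * (s *\<^sub>R 1 - y) = t *\<^sub>R 1 - p"
    "\<And>z. z * p = p * z \<Longrightarrow> z * y = y * z"
proof (cases "t = 0")
  case True
  then have "p = 0" using p by simp
  then show ?thesis using True by (intro that[of 0 0]) auto
next
  case False
  then have t: "t > 0" using p(2) norm_ge_zero[of p] by (auto simp del: norm_ge_zero)
  have "star ((1/t) *\<^sub>R p) = (1/t) *\<^sub>R p" "norm ((1/t) *\<^sub>R p) \<le> 1"
    using p t by (simp_all add: star_simps field_simps)
  then obtain y where y: "star y = y" "norm y \<le> 1" "(1 - y) * (1 - y) = 1 - (1/t) *\<^sub>R p"
    "\<And>z. z * ((1/t) *\<^sub>R p) = ((1/t) *\<^sub>R p) * z \<Longrightarrow> z * y = y * z"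
    by (rule sqrt_one_minus) blast
  show ?thesis
  proof (rule that[of "sqrt t *\<^sub>R y" "sqrt t"])
    have "(sqrt t *\<^sub>R 1 - sqrt t *\<^sub>R y) * (sqrt t *\<^sub>R 1 - sqrt t *\<^sub>R y)
        = (sqrt t * sqrt t) *\<^sub>R ((1 - y) * (1 - y))"
      by (simp flip: scaleR_diff_right)
    also have "\<dots> = t *\<^sub>R 1 - p" unfolding y(3) using t by (simp add: scaleR_diff_right)
    finally show "(sqrt t *\<^sub>R 1 - sqrt t *\<^sub>R y) * (sqrt t *\<^sub>R 1 - sqrt t *\<^sub>R y) = t *\<^sub>R 1 - p" .
  qed (use y t in \<open>auto simp: star_simps\<close>)
qed

section \<open>Spectra of self-adjoint elements\<close>

lemma cstar_spectrum_shift: "z \<in> cstar_spectrum (t *\<^sub>R 1 - a) \<longleftrightarrow> of_real t - z \<in> cstar_spectrum a"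
proof -
  have "z *\<^sub>C 1 - (t *\<^sub>R 1 - a) = - ((of_real t - z) *\<^sub>C 1 - a)"
    by (simp add: scaleC_diff_left scaleR_scaleC)
  then show ?thesis unfolding in_cstar_spectrum by (simp only: unit_elt_minus)
qed

text \<open>M - h^2 is itself a square k^2 with k commuting with h, so its norm is at most that of
  k^2 + h^2 = M. This is positivity of h^2 in norm form.\<close>

lemma norm_scalar_minus_square:
  fixes h :: "'a::cstar_algebra"
  assumes h: "star h = h" and M: "norm (h * h) \<le> M"
  shows "norm (M *\<^sub>R 1 - h * h) \<le> M"
proof -
  have "star (h * h) = h * h" by (simp add: star_mult h)
  then obtain s y where y: "star y = y" "(s *\<^sub>R 1 - y) * (s *\<^sub>R 1 - y) = M *\<^sub>R 1 - h * h"
    "\<And>z. z * (h * h) = h * h * z \<Longrightarrow> z * y = y * z"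
    using M by (rule sqrt_scalar_minus) blast
  have hy: "h * y = y * h" by (rule y(3)) (simp add: mult.assoc)
  have "norm ((s *\<^sub>R 1 - y) * (s *\<^sub>R 1 - y)) \<le> norm ((s *\<^sub>R 1 - y) * (s *\<^sub>R 1 - y) + h * h)"
    by (rule norm_square_le_add_square) (simp_all add: star_simps y(1) h algebra_simps hy)
  also have "\<dots> = norm (M *\<^sub>R (1::'a))" by (simp add: y(2))
  also have "\<dots> \<le> M"
    using norm_one_le[where 'a='a] order_trans[OF norm_ge_zero M] by (simp add: mult_left_le)
  finally show ?thesis by (simp add: y(2))
qed

text \<open>Write s + h^2 = (s + M) - (M - h^2); the subtracted term has norm at most M < s +
  M.\<close>

lemma unit_elt_add_square:
  fixes h :: "'a::cstar_algebra"
  assumes h: "star h = h" and s: "s > 0"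
  shows "unit_elt (s *\<^sub>R 1 + h * h)"
proof -
  define M where "M = norm (h * h)"
  have "M \<ge> 0" by (simp add: M_def)
  have "norm (M *\<^sub>R 1 - h * h) \<le> M" using norm_scalar_minus_square[OF h] by (simp add: M_def)
  then have "unit_elt (of_real (s + M) *\<^sub>C 1 - (M *\<^sub>R 1 - h * h))"
    using s \<open>M \<ge> 0\<close> by (intro unit_elt_diff) (simp del: of_real_add)
  then show ?thesis by (simp add: scaleR_scaleC scaleC_add_left)
qed

text \<open>With k = Re z - h, the commuting factors k + i Im z = z - h and k - i Im z have product
  k^2 + (Im z)^2, which is invertible when Im z is nonzero.\<close>

lemma selfadjoint_spectrum_real:
  fixes h :: "'a::cstar_algebra"
  assumes h: "star h = h" and z: "z \<in> cstar_spectrum h"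
  shows "Im z = 0"
proof (rule ccontr)
  assume im: "Im z \<noteq> 0"
  define k where "k = Re z *\<^sub>R 1 - h"
  have k: "star k = k" by (simp add: k_def star_simps h)
  have zk: "z *\<^sub>C 1 - h = k + (\<i> * of_real (Im z)) *\<^sub>C 1"
    by (subst complex_eq[of z]) (simp add: k_def scaleR_scaleC scaleC_add_left)
  let ?w = "(\<i> * of_real (Im z)) *\<^sub>C 1 :: 'a"
  have ww: "?w * ?w = - ((Im z)\<^sup>2 *\<^sub>R 1)"
  proof -
    have "\<i> * of_real (Im z) * (\<i> * of_real (Im z)) = - complex_of_real ((Im z)\<^sup>2)"
      by (simp add: complex_eq_iff power2_eq_square)
    then show ?thesis
      by (simp only: mult_scaleC_left mult_scaleC_right scaleC_scaleC scaleR_scaleC mult_1_left scaleC_minus_left)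
  qed
  have kw: "k * ?w = ?w * k" by (simp add: mult_scaleC_left mult_scaleC_right)
  have "(k + ?w) * (k - ?w) = (Im z)\<^sup>2 *\<^sub>R 1 + k * k"
    by (simp add: distrib_left distrib_right left_diff_distrib right_diff_distrib ww kw)
  moreover have "(k + ?w) * (k - ?w) = (k - ?w) * (k + ?w)"
    by (simp add: algebra_simps kw)
  moreover have "unit_elt ((Im z)\<^sup>2 *\<^sub>R 1 + k * k)"
    using im by (intro unit_elt_add_square k) simp
  ultimately have "unit_elt (k + ?w)" using unit_elt_factor by metis
  then show False using z by (simp add: in_cstar_spectrum zk)
qed

lemma positive_iff_spectrum:
  "cstar_positive a \<longleftrightarrow> star a = a \<and> (\<forall>t. complex_of_real t \<in> cstar_spectrum a \<longrightarrow> 0 \<le> t)"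
proof -
  have "0 \<le> Re z" if "star a = a" "\<And>t. complex_of_real t \<in> cstar_spectrum a \<Longrightarrow> 0 \<le> t"
    "z \<in> cstar_spectrum a" for z
  proof -
    have "z = of_real (Re z)" using selfadjoint_spectrum_real[OF that(1,3)] by (simp add: complex_eq_iff)
    then show ?thesis using that(2,3) by metis
  qed
  then show ?thesis unfolding cstar_positive_def
    using selfadjoint_spectrum_real by (fastforce simp: subset_iff complex_nonneg_Reals_iff)
qed

lemma positive_spectrum: "cstar_positive a \<Longrightarrow> complex_of_real t \<in> cstar_spectrum a \<Longrightarrow> 0 \<le> t"
  by (simp add: positive_iff_spectrum)

text \<open>If \<open>\<plusminus>\<parallel>a\<parallel>\<close> were both outside the spectrum, then \<open>\<parallel>a\<parallel>\<^sup>2 - a\<^sup>2 = c\<^sup>2\<close> with \<open>c\<close> invertible, so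
  \<open>c\<^sup>2 - 1/\<beta>\<close> is a square \<open>d\<^sup>2\<close> for large \<open>\<beta>\<close> and \<open>\<parallel>a\<^sup>2\<parallel> \<le> \<parallel>a\<^sup>2 + d\<^sup>2\<parallel> = \<parallel>a\<parallel>\<^sup>2 - 1/\<beta>\<close>.\<close>

lemma norm_in_spectrum:
  fixes a :: "'a::cstar_algebra"
  assumes a: "star a = a" "a \<noteq> 0"
  shows "of_real (norm a) \<in> cstar_spectrum a \<or> of_real (- norm a) \<in> cstar_spectrum a"
proof (rule ccontr)
  assume neg: "\<not> ?thesis"
  define s where "s = norm a"
  have s: "s > 0" using a by (simp add: s_def)
  have "unit_elt (s *\<^sub>R 1 - a)" "unit_elt ((- s) *\<^sub>R 1 - a)"
    using neg unfolding in_cstar_spectrum s_def scaleR_scaleC by blast+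
  then have "unit_elt ((s *\<^sub>R 1 - a) * - ((- s) *\<^sub>R 1 - a))"
    unfolding unit_elt_minus by (intro unit_elt_mult) (simp_all only: unit_elt_minus)
  then have uD: "unit_elt (s\<^sup>2 *\<^sub>R 1 - a * a)" by (simp add: algebra_simps power2_eq_square)
  have "star (a * a) = a * a" "norm (a * a) \<le> s\<^sup>2"
    using a by (simp_all add: star_mult norm_selfadjoint_square s_def)
  then obtain r y where y: "star y = y" "(r *\<^sub>R 1 - y) * (r *\<^sub>R 1 - y) = s\<^sup>2 *\<^sub>R 1 - a * a"
    "\<And>z. z * (a * a) = a * a * z \<Longrightarrow> z * y = y * z"
    by (rule sqrt_scalar_minus) blast
  define c where "c = r *\<^sub>R 1 - y"
  have c: "star c = c" "c * c = s\<^sup>2 *\<^sub>R 1 - a * a" using y by (simp_all add: c_def star_simps)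
  have "a * y = y * a" by (rule y(3)) (simp add: mult.assoc)
  then have ac: "a * c = c * a" by (simp add: c_def algebra_simps)
  have "unit_elt c" using uD c(2) unit_elt_factor[of c c] by simp
  then obtain b where b: "b * c = 1" "c * b = 1" unfolding unit_elt_def by blast
  have "star b * c = 1" using arg_cong[OF b(2), of star] by (simp add: star_mult c)
  then have sb: "star b = b" using b by (metis mult.assoc mult_1_left mult_1_right)
  have ab: "a * b = b * a"
  proof -
    have "b * (a * c) * b = b * (c * a) * b" by (simp only: ac)
    then have "(b * a) * (c * b) = (b * c) * (a * b)" by (simp only: mult.assoc)
    then show ?thesis by (simp add: b)
  qed
  have one: "norm (1::'a) = 1" using norm_one_cases[where 'a='a] a(2) by blast
  \<comment> \<open>The first bound gives beta - b^2 a square root; the second keeps s^2 - 1 / beta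
    nonnegative, so that it is the norm of the scalar it defines.\<close>
  define \<beta> where "\<beta> = max (norm (b * b)) (1 / s\<^sup>2)"
  have "1 / s\<^sup>2 > 0" "1 / s\<^sup>2 \<le> \<beta>" using s by (auto simp: \<beta>_def)
  then have "\<beta> > 0" by linarith
  with \<open>1 / s\<^sup>2 \<le> \<beta>\<close> have \<beta>: "\<beta> > 0" "1 / \<beta> \<le> s\<^sup>2" using s by (simp_all add: field_simps)
  have "star (b * b) = b * b" "norm (b * b) \<le> \<beta>" by (simp_all add: star_mult sb \<beta>_def)
  then obtain q x where x: "star x = x" "(q *\<^sub>R 1 - x) * (q *\<^sub>R 1 - x) = \<beta> *\<^sub>R 1 - b * b"
    "\<And>z. z * (b * b) = b * b * z \<Longrightarrow> z * x = x * z"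
    by (rule sqrt_scalar_minus) blast
  define e where "e = q *\<^sub>R 1 - x"
  have e: "star e = e" "e * e = \<beta> *\<^sub>R 1 - b * b" using x by (simp_all add: e_def star_simps)
  have "c * (b * b) = b * b * c" by (metis b mult.assoc mult_1_left mult_1_right)
  from x(3)[OF this] have ce: "c * e = e * c" by (simp add: e_def algebra_simps)
  have "a * (b * b) = b * b * a" by (metis ab mult.assoc)
  from x(3)[OF this] have ae: "a * e = e * a" by (simp add: e_def algebra_simps)
  \<comment> \<open>Since b inverts c and e^2 = beta - b^2, the square of d is c^2 (beta - b^2) /
    beta = c^2 - 1 / beta.\<close>
  define d where "d = (1 / sqrt \<beta>) *\<^sub>R (e * c)"
  have d: "star d = d" by (simp add: d_def star_simps e c ce)
  have ad: "a * d = d * a"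
  proof -
    have "a * (e * c) = (e * c) * a" by (metis ae ac mult.assoc)
    then show ?thesis by (simp add: d_def)
  qed
  have "(e * c) * (e * c) = c * (e * e) * c" by (metis ce mult.assoc)
  also have "\<dots> = \<beta> *\<^sub>R (c * c) - (c * b) * (b * c)" by (simp add: e algebra_simps)
  finally have "(e * c) * (e * c) = \<beta> *\<^sub>R (c * c) - 1" by (simp add: b)
  then have "d * d = c * c - (1 / \<beta>) *\<^sub>R 1" using \<beta> by (simp add: d_def scaleR_diff_right)
  then have ad2: "a * a + d * d = (s\<^sup>2 - 1 / \<beta>) *\<^sub>R 1" by (simp add: c scaleR_diff_left)
  have "s\<^sup>2 \<le> norm (a * a + d * d)"
    using norm_square_le_add_square[OF a(1) d ad] a by (simp add: norm_selfadjoint_square s_def)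
  also have "\<dots> = s\<^sup>2 - 1 / \<beta>" unfolding ad2 using \<beta> by (simp add: one)
  finally show False using \<beta> by simp
qed

text \<open>Passing from a to t - a reflects the spectrum. If a is positive, its spectrum lies in
  [0, t], hence so does that of t - a, which contains plus or minus its norm. Conversely, r < 0 in
  the spectrum of a would put t - r > t into that of t - a.\<close>

lemma positive_iff_norm:
  fixes a :: "'a::cstar_algebra"
  assumes a: "star a = a" and t: "norm a \<le> t"
  shows "cstar_positive a \<longleftrightarrow> norm (t *\<^sub>R 1 - a) \<le> t"
proof
  assume p: "cstar_positive a"
  have sa: "star (t *\<^sub>R 1 - a) = t *\<^sub>R 1 - a" by (simp add: star_simps a)
  let ?n = "norm (t *\<^sub>R 1 - a)"
  have t0: "t \<ge> 0" using t norm_ge_zero order_trans by blast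
  have spec: "r \<in> {0..t}" if "of_real r \<in> cstar_spectrum a" for r
  proof -
    have "cmod (of_real r) \<le> norm a"
      using that unit_elt_diff[of a "of_real r"] unfolding in_cstar_spectrum by (meson not_le)
    moreover have "0 \<le> r" using that p by (simp add: positive_iff_spectrum)
    ultimately show ?thesis using t by simp
  qed
  show "?n \<le> t"
  proof (cases "t *\<^sub>R 1 - a = 0")
    case False
    then consider "of_real ?n \<in> cstar_spectrum (t *\<^sub>R 1 - a)" | "of_real (- ?n) \<in> cstar_spectrum (t *\<^sub>R 1 - a)"
      using norm_in_spectrum[OF sa] by blast
    then show ?thesis
    proof cases
      case 1
      then have "of_real (t - ?n) \<in> cstar_spectrum a" unfolding cstar_spectrum_shift by simp
      then show ?thesis using spec[of "t - ?n"] by simp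
    next
      case 2
      then have "of_real (t + ?n) \<in> cstar_spectrum a" unfolding cstar_spectrum_shift by simp
      then show ?thesis using spec[of "t + ?n"] t0 by simp
    qed
  qed (simp add: t0)
next
  assume n: "norm (t *\<^sub>R 1 - a) \<le> t"
  show "cstar_positive a" unfolding positive_iff_spectrum
  proof (intro conjI allI impI a)
    fix r assume r: "of_real r \<in> cstar_spectrum a"
    have "unit_elt (of_real (t - r) *\<^sub>C 1 - (t *\<^sub>R 1 - a))" if "r < 0"
      using n that by (intro unit_elt_diff) (simp del: of_real_diff)
    moreover have "of_real (t - r) \<in> cstar_spectrum (t *\<^sub>R 1 - a)"
      unfolding cstar_spectrum_shift using r by simp
    ultimately show "0 \<le> r" by (force simp: in_cstar_spectrum not_le[symmetric])
  qed
qed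

section \<open>The positive cone\<close>

lemma positive_selfadjoint: "cstar_positive a \<Longrightarrow> star a = a"
  by (simp add: cstar_positive_def)

lemma positive_square:
  fixes h :: "'a::cstar_algebra"
  assumes h: "star h = h" shows "cstar_positive (h * h)"
  using norm_scalar_minus_square[OF h order.refl]
  by (subst positive_iff_norm[OF _ order.refl]) (simp_all add: star_mult h)

text \<open>\<open>positive_iff_norm\<close> admits any bound t on the norm; with t = norm a + norm
  b it reduces the claim to the triangle inequality.\<close>

lemma positive_add:
  fixes a b :: "'a::cstar_algebra"
  assumes "cstar_positive a" "cstar_positive b" shows "cstar_positive (a + b)"
proof -
  note sa = assms[THEN positive_selfadjoint]
  have "norm (norm a *\<^sub>R 1 - a) \<le> norm a" "norm (norm b *\<^sub>R 1 - b) \<le> norm b"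
    using positive_iff_norm[OF sa(1) order.refl] positive_iff_norm[OF sa(2) order.refl] assms by simp_all
  then have "norm ((norm a *\<^sub>R 1 - a) + (norm b *\<^sub>R 1 - b)) \<le> norm a + norm b"
    by (rule norm_triangle_mono)
  then have "norm ((norm a + norm b) *\<^sub>R 1 - (a + b)) \<le> norm a + norm b"
    by (simp add: algebra_simps)
  moreover have "star (a + b) = a + b" by (simp add: star_add sa)
  ultimately show ?thesis using positive_iff_norm[OF _ norm_triangle_ineq] by blast
qed

lemma positive_scaleR:
  fixes a :: "'a::cstar_algebra"
  assumes a: "cstar_positive a" and r: "r \<ge> 0" shows "cstar_positive (r *\<^sub>R a)"
proof -
  have sa: "star a = a" by (rule positive_selfadjoint[OF a])
  have "norm (norm a *\<^sub>R 1 - a) \<le> norm a" using positive_iff_norm[OF sa order.refl] a by simp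
  then have "norm (r *\<^sub>R (norm a *\<^sub>R 1 - a)) \<le> r * norm a" using r by (simp add: mult_left_mono)
  then have "norm ((r * norm a) *\<^sub>R 1 - r *\<^sub>R a) \<le> r * norm a" by (simp add: scaleR_diff_right)
  then show ?thesis using positive_iff_norm[of "r *\<^sub>R a" "r * norm a"] r by (simp add: star_scaleR sa)
qed

lemma positive_one: "cstar_positive (1::'a::cstar_algebra)"
  using positive_square[of 1] by simp

lemma positive_scalar_minus:
  fixes a :: "'a::cstar_algebra"
  assumes a: "star a = a" and t: "norm a \<le> t" shows "cstar_positive (t *\<^sub>R 1 - a)"
proof -
  obtain s y where y: "star y = y" "(s *\<^sub>R 1 - y) * (s *\<^sub>R 1 - y) = t *\<^sub>R 1 - a"
    using a t by (rule sqrt_scalar_minus) blast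
  have "star (s *\<^sub>R 1 - y) = s *\<^sub>R 1 - y" by (simp add: star_simps y)
  from positive_square[OF this] show ?thesis by (simp add: y)
qed

text \<open>With t = norm a, positivity of a says norm (t - a) <= t, so
  \<open>sqrt_scalar_minus\<close> applies to a = t - (t - a).\<close>

lemma positive_sqrt:
  fixes a :: "'a::cstar_algebra"
  assumes a: "cstar_positive a"
  obtains c where "cstar_positive c" "c * c = a" "\<And>z. z * a = a * z \<Longrightarrow> z * c = c * z"
proof -
  define t where "t = norm a"
  have sa: "star a = a" by (rule positive_selfadjoint[OF a])
  have "star (t *\<^sub>R 1 - a) = t *\<^sub>R 1 - a" "norm (t *\<^sub>R 1 - a) \<le> t"
    using positive_iff_norm[OF sa, of t] a by (simp_all add: star_simps sa t_def)
  then obtain s y where y: "star y = y" "norm y \<le> s"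
    "(s *\<^sub>R 1 - y) * (s *\<^sub>R 1 - y) = t *\<^sub>R 1 - (t *\<^sub>R 1 - a)"
    "\<And>z. z * (t *\<^sub>R 1 - a) = (t *\<^sub>R 1 - a) * z \<Longrightarrow> z * y = y * z"
    by (rule sqrt_scalar_minus) blast
  show thesis
  proof
    show "cstar_positive (s *\<^sub>R 1 - y)" using y by (intro positive_scalar_minus)
    show "(s *\<^sub>R 1 - y) * (s *\<^sub>R 1 - y) = a" by (simp add: y)
    show "z * (s *\<^sub>R 1 - y) = (s *\<^sub>R 1 - y) * z" if "z * a = a * z" for z
      using y(4)[of z] that by (simp add: algebra_simps)
  qed
qed

section \<open>Positivity of \<open>star x * x\<close>\<close>

lemma cstar_spectrum_mult_commute:
  fixes x y :: "'a::cstar_algebra"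
  assumes z: "z \<noteq> 0" "z \<in> cstar_spectrum (y * x)" shows "z \<in> cstar_spectrum (x * y)"
proof (rule ccontr)
  assume "z \<notin> cstar_spectrum (x * y)"
  then obtain b where b: "b * (z *\<^sub>C 1 - x * y) = 1" "(z *\<^sub>C 1 - x * y) * b = 1"
    unfolding not_in_cstar_spectrum unit_elt_def by blast
  then have b': "b * x * y = z *\<^sub>C b - 1" "x * y * b = z *\<^sub>C b - 1"
    by (simp_all add: right_diff_distrib left_diff_distrib mult_scaleC_left mult_scaleC_right
        eq_diff_eq diff_eq_eq mult.assoc add.commute)
  \<comment> \<open>Comparing the geometric series of the inverses of z - xy and z - yx suggests (1
    + y b x) / z as the inverse of z - yx.\<close>
  have "(1 + y * b * x) * (z *\<^sub>C 1 - y * x)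
      = z *\<^sub>C 1 + z *\<^sub>C (y * b * x) - y * x - y * (b * x * y) * x"
    by (simp add: algebra_simps mult_scaleC_left mult_scaleC_right scaleC_add_right scaleC_diff_right)
  also have "\<dots> = z *\<^sub>C 1"
    unfolding b' by (simp add: algebra_simps mult_scaleC_left mult_scaleC_right scaleC_add_right scaleC_diff_right)
  finally have l: "(1 + y * b * x) * (z *\<^sub>C 1 - y * x) = z *\<^sub>C 1" .
  have "(z *\<^sub>C 1 - y * x) * (1 + y * b * x)
      = z *\<^sub>C 1 + z *\<^sub>C (y * b * x) - y * x - y * (x * y * b) * x"
    by (simp add: algebra_simps mult_scaleC_left mult_scaleC_right scaleC_add_right scaleC_diff_right)
  also have "\<dots> = z *\<^sub>C 1"
    unfolding b' by (simp add: algebra_simps mult_scaleC_left mult_scaleC_right scaleC_add_right scaleC_diff_right)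
  finally have r: "(z *\<^sub>C 1 - y * x) * (1 + y * b * x) = z *\<^sub>C 1" .
  have "unit_elt (z *\<^sub>C 1 - y * x)"
    using l r z(1) by (intro unit_eltI[of "inverse z *\<^sub>C (1 + y * b * x)" _ "inverse z *\<^sub>C (1 + y * b * x)"])
      (simp_all only: mult_scaleC_left mult_scaleC_right scaleC_scaleC left_inverse scaleC_one not_False_eq_True)
  then show False using z(2) by (simp add: in_cstar_spectrum)
qed

text \<open>\<open>u\<close> and \<open>v\<close> are the real and imaginary parts up to scaling: y
  = (u - i v) / sqrt 2. The cross terms of the two products cancel.\<close>

lemma add_mult_star_eq_squares:
  fixes y :: "'a::cstar_algebra"
  obtains u v where "star u = u" "star v = v" "y * star y + star y * y = u * u + v * v"
proof
  let ?u = "(1 / sqrt 2) *\<^sub>R (y + star y)" and ?v = "\<i> *\<^sub>C (1 / sqrt 2) *\<^sub>R (y - star y)"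
  show "star ?u = ?u" by (simp add: star_simps add.commute)
  have "- (y - star y) = star y - y" by simp
  then show "star ?v = ?v" by (simp add: star_simps star_scaleC scaleC_minus_left flip: scaleC_minus_right scaleR_minus_right)
  have "?u * ?u = (1/2) *\<^sub>R ((y + star y) * (y + star y))" by simp
  moreover have "?v * ?v = (\<i> * of_real (1 / sqrt 2) * (\<i> * of_real (1 / sqrt 2))) *\<^sub>C ((y - star y) * (y - star y))"
    by (simp only: mult_scaleC_left mult_scaleC_right scaleC_scaleC scaleR_scaleC mult_ac)
  moreover have "\<i> * of_real (1 / sqrt 2) * (\<i> * of_real (1 / sqrt 2)) = - complex_of_real (1 / 2)"
    by (simp add: complex_eq_iff)
  moreover have "(y + star y) * (y + star y) - (y - star y) * (y - star y) = 2 *\<^sub>R (y * star y + star y * y)"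
    by (simp add: algebra_simps scaleR_2)
  ultimately have "?u * ?u + ?v * ?v = (1/2) *\<^sub>R (2 *\<^sub>R (y * star y + star y * y))"
    by (simp only: scaleC_minus_left add_uminus_conv_diff flip: scaleR_scaleC scaleR_diff_right)
  then show "y * star y + star y * y = ?u * ?u + ?v * ?v" by simp
qed

text \<open>Subtracting \<open>star y * y\<close> from the sum of squares shows that
  \<open>y * star y\<close> is positive. Apart from 0 its spectrum is that of
  \<open>star y * y\<close>, minus a square, so it has no positive point either; its norm must be
  0.\<close>

lemma star_mult_neg_square_eq_zero:
  fixes y s :: "'a::cstar_algebra"
  assumes s: "star s = s" and y: "star y * y = - (s * s)"
  shows "y = 0"
proof -
  obtain u v where uv: "star u = u" "star v = v" "y * star y + star y * y = u * u + v * v"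
    by (rule add_mult_star_eq_squares)
  have "y * star y = u * u + v * v + s * s" using uv(3) y by (simp add: algebra_simps)
  then have pos: "cstar_positive (y * star y)"
    by (auto intro!: positive_add positive_square uv s)
  have sa: "star (y * star y) = y * star y" by (simp add: star_simps)
  have le: "r \<le> 0" if "of_real r \<in> cstar_spectrum (y * star y)" for r
  proof (rule ccontr)
    assume r: "\<not> r \<le> 0"
    then have "of_real r \<in> cstar_spectrum (star y * y)"
      using cstar_spectrum_mult_commute[OF _ that] by simp
    then have "of_real (- r) \<in> cstar_spectrum (s * s)"
      using cstar_spectrum_shift[of "of_real r" 0 "s * s"] by (simp add: y)
    from positive_spectrum[OF positive_square[OF s] this] show False using r by simp
  qed
  have "y * star y = 0"
  proof (rule ccontr)
    assume nz: "y * star y \<noteq> 0"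
    then show False
      using norm_in_spectrum[OF sa nz] le[of "norm (y * star y)"] pos
      unfolding positive_iff_spectrum by fastforce
  qed
  then have "star y = 0" using norm_star_mult[of "star y"] by (simp add: star_star)
  then show ?thesis using norm_star[of y] by simp
qed

text \<open>With \<open>a = x\<^sup>* x\<close>, \<open>m = |a|\<close> and \<open>b = m - a\<close> (twice the negative part of \<open>a\<close>), \<open>(xb)\<^sup>* xb = -m b\<^sup>2\<close> is
  minus a square, so it vanishes.\<close>

lemma positive_star_mult: "cstar_positive (star x * x :: 'a::cstar_algebra)"
proof -
  define a where "a = star x * x"
  have a: "star a = a" by (simp add: a_def star_simps)
  obtain m where m: "cstar_positive m" "m * m = a * a" "\<And>z. z * (a * a) = a * a * z \<Longrightarrow> z * m = m * z"
    using positive_sqrt[OF positive_square[OF a]] by blast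
  have am: "a * m = m * a" by (rule m(3)) (simp add: mult.assoc)
  \<comment> \<open>The root n of m exhibits m b^2 as the square of the self-adjoint n b.\<close>
  obtain n where n: "cstar_positive n" "n * n = m" "\<And>z. z * m = m * z \<Longrightarrow> z * n = n * z"
    using positive_sqrt[OF m(1)] by blast
  have an: "a * n = n * a" by (rule n(3)[OF am])
  have mn: "m * n = n * m" by (rule n(3)) simp
  note sm = positive_selfadjoint[OF m(1)] and sn = positive_selfadjoint[OF n(1)]
  define b where "b = m - a"
  have b: "star b = b" by (simp add: b_def star_simps sm a)
  have nb: "n * b = b * n" by (simp add: b_def algebra_simps an mn)
  have ab: "a * b = - (m * b)" by (simp add: b_def algebra_simps am m(2))
  have bb: "b * b = 2 *\<^sub>R (m * b)"
    using ab by (simp add: b_def left_diff_distrib scaleR_2)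
  define s where "s = n * b"
  have s: "star s = s" by (simp add: s_def star_simps sn b nb)
  have ss: "s * s = m * (b * b)" unfolding s_def by (metis n(2) nb mult.assoc)
  have ba: "b * a = a * b" by (simp add: b_def algebra_simps am)
  have "star (x * b) * (x * b) = b * a * b" by (simp add: star_simps b a_def mult.assoc)
  also have "\<dots> = - (s * s)" by (simp add: ba ab ss mult.assoc)
  finally have "x * b = 0" by (rule star_mult_neg_square_eq_zero[OF s])
  then have "a * b = 0" by (simp add: a_def mult.assoc)
  \<comment> \<open>Here m b = - a b vanishes too, and b^2 = 2 m b.\<close>
  then have "b * b = 0" using ab bb by simp
  then have "b = 0" by (rule square_eq_zero_selfadjoint[OF b])
  then show ?thesis using m(1) by (simp add: b_def a_def)
qed

lemma positive_conj:
  fixes p h :: "'a::cstar_algebra"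
  assumes p: "cstar_positive p" shows "cstar_positive (star h * p * h)"
proof -
  obtain c where c: "cstar_positive c" "c * c = p" using positive_sqrt[OF p] by blast
  have "star (c * h) * (c * h) = star h * p * h"
    by (simp add: star_mult positive_selfadjoint[OF c(1)] mult.assoc flip: c(2))
  then show ?thesis using positive_star_mult[of "c * h"] by simp
qed

section \<open>Order and norm\<close>

lemma norm_le_iff_positive:
  fixes a :: "'a::cstar_algebra"
  assumes a: "cstar_positive a" and t: "cstar_positive (t *\<^sub>R 1 - a)" "t \<ge> 0"
  shows "norm a \<le> t"
proof (cases "a = 0")
  case False
  note sa = positive_selfadjoint[OF a]
  have "of_real (norm a) \<in> cstar_spectrum a"
    using norm_in_spectrum[OF sa False] a False unfolding positive_iff_spectrum by fastforce
  then have "of_real (t - norm a) \<in> cstar_spectrum (t *\<^sub>R 1 - a)"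
    unfolding cstar_spectrum_shift by simp
  from positive_spectrum[OF t(1) this] show ?thesis by simp
qed (simp add: t)

lemma norm_mono_positive:
  fixes a b :: "'a::cstar_algebra"
  assumes a: "cstar_positive a" and ab: "cstar_positive (b - a)"
  shows "norm a \<le> norm b"
proof (rule norm_le_iff_positive[OF a])
  have "star b = star a + star (b - a)" by (simp add: star_diff)
  then have "star b = b" using assms[THEN positive_selfadjoint] by simp
  \<comment> \<open>norm b - a is split as (norm b - b) + (b - a).\<close>
  then have "cstar_positive ((norm b *\<^sub>R 1 - b) + (b - a))"
    by (intro positive_add positive_scalar_minus ab) auto
  then show "cstar_positive (norm b *\<^sub>R 1 - a)" by simp
qed simp

text \<open>The perturbation v is dominated by the scalar norm v, and adding a scalar only shifts
  the spectrum.\<close>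

lemma positive_closed:
  fixes a v :: "'a::cstar_algebra"
  assumes sv: "star v = v" and pos: "\<And>\<epsilon>. \<epsilon> > 0 \<Longrightarrow> cstar_positive (a + \<epsilon> *\<^sub>R v)"
  shows "cstar_positive a"
proof -
  have "star (a + v) = a + v" using pos[of 1] positive_selfadjoint by fastforce
  then have sa: "star a = a" by (simp add: star_add sv)
  show ?thesis unfolding positive_iff_spectrum
  proof (intro conjI allI impI sa, rule ccontr)
    fix r assume r: "of_real r \<in> cstar_spectrum a" and "\<not> 0 \<le> r"
    \<comment> \<open>Chosen so that epsilon * norm v + r = - epsilon < 0; the summand 1 also covers
      v = 0.\<close>
    define \<epsilon> where "\<epsilon> = - r / (norm v + 1)"
    have v1: "norm v + 1 > 0" using norm_ge_zero[of v] by linarith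
    have \<epsilon>: "\<epsilon> > 0" using \<open>\<not> 0 \<le> r\<close> v1 by (simp add: \<epsilon>_def field_simps)
    have "cstar_positive ((a + \<epsilon> *\<^sub>R v) + \<epsilon> *\<^sub>R (norm v *\<^sub>R 1 - v))"
      using \<epsilon> sv by (intro positive_add pos positive_scaleR positive_scalar_minus) auto
    then have p: "cstar_positive ((\<epsilon> * norm v) *\<^sub>R 1 + a)" by (simp add: scaleR_diff_right add.commute)
    have "of_real (\<epsilon> * norm v + r) \<in> cstar_spectrum ((\<epsilon> * norm v) *\<^sub>R 1 + a)"
      using r cstar_spectrum_shift[of "of_real (\<epsilon> * norm v + r)" "\<epsilon> * norm v" "-a"]
        cstar_spectrum_shift[of "- of_real r" 0 a] by simp
    then have "0 \<le> \<epsilon> * norm v + r" using p by (auto simp: positive_iff_spectrum simp del: of_real_add)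
    moreover have "\<epsilon> * (norm v + 1) = - r" using v1 by (simp add: \<epsilon>_def)
    ultimately show False using \<epsilon> by (simp add: algebra_simps)
  qed
qed

text \<open>Take \<open>h = (p + \<epsilon>)\<^sup>-\<^sup>1\<^sup>/\<^sup>2\<close>: then \<open>\<parallel>h p h\<parallel> \<le> 1\<close>, hence \<open>h q h \<le> 1\<close>, that is \<open>q \<le> p + \<epsilon>\<close>.\<close>

lemma le_of_norm_conj_le:
  fixes p q :: "'a::cstar_algebra"
  assumes p: "cstar_positive p" and q: "star q = q"
    and le: "\<And>h. star h = h \<Longrightarrow> norm (h * q * h) \<le> norm (h * p * h)"
  shows "cstar_positive (p - q)"
proof (rule positive_closed[of 1])
  fix \<epsilon> :: real assume \<epsilon>: "\<epsilon> > 0"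
  have pe: "cstar_positive (p + \<epsilon> *\<^sub>R 1)" using \<epsilon> by (intro positive_add positive_scaleR positive_one p) simp
  then obtain k where k: "cstar_positive k" "k * k = p + \<epsilon> *\<^sub>R 1" using positive_sqrt by blast
  note sk = positive_selfadjoint[OF k(1)]
  have "of_real (- \<epsilon>) \<notin> cstar_spectrum p" using p \<epsilon> by (auto simp: positive_iff_spectrum simp del: of_real_minus)
  then have "unit_elt ((- \<epsilon>) *\<^sub>R 1 - p)" by (simp only: not_in_cstar_spectrum scaleR_scaleC)
  moreover have "(- \<epsilon>) *\<^sub>R 1 - p = - (k * k)" by (simp add: k)
  ultimately have "unit_elt (k * k)" by (simp add: unit_elt_minus)
  then have "unit_elt k" using unit_elt_factor[of k k] by simp
  then obtain h where h: "h * k = 1" "k * h = 1" unfolding unit_elt_def by blast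
  have "star h * k = 1" using arg_cong[OF h(2), of star] by (simp add: star_mult sk)
  then have sh: "star h = h" using h by (metis mult.assoc mult_1_left mult_1_right)
  have "h * (k * k) * h = (h * k) * (k * h)" by (simp only: mult.assoc)
  then have "1 - h * p * h = \<epsilon> *\<^sub>R (h * h)" by (simp add: h k algebra_simps)
  then have "cstar_positive (1 *\<^sub>R 1 - h * p * h)" using \<epsilon> by (simp add: positive_scaleR positive_square sh)
  moreover have "cstar_positive (h * p * h)" using positive_conj[OF p, of h] by (simp add: sh)
  ultimately have "norm (h * p * h) \<le> 1" using norm_le_iff_positive[of "h * p * h" 1] by simp
  then have "norm (h * q * h) \<le> 1" using le[OF sh] by linarith
  then have "cstar_positive (1 *\<^sub>R 1 - h * q * h)"
    by (intro positive_scalar_minus) (simp_all add: star_simps sh q mult.assoc)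
  from positive_conj[OF this, of k] have "cstar_positive (k * (1 - h * q * h) * k)" by (simp add: sk)
  moreover have "k * (1 - h * q * h) * k = k * k - (k * h) * q * (h * k)" by (simp add: algebra_simps)
  ultimately show "cstar_positive (p - q + \<epsilon> *\<^sub>R 1)" by (simp add: h k algebra_simps)
qed simp

section \<open>Adjointable operators on a Hilbert module\<close>

text \<open>Separates z from the half-line: theta turns the nonnegative reals into the closed left
  half-plane and z into the open right one. In \<open>op_positiveI\<close> this makes the form of
  theta (z - P) coercive.\<close>

lemma not_nonneg_Reals_rotate:
  assumes "z \<notin> \<real>\<^sub>\<ge>\<^sub>0" obtains \<theta> where "Re \<theta> \<le> 0" "Re (\<theta> * z) > 0"
proof -
  consider "Re z < 0" | "Im z > 0" | "Im z < 0"
    using assms by (auto simp: complex_nonneg_Reals_iff not_le) linarith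
  then show thesis
    by cases (rule that[of "-1"] that[of "- \<i>"] that[of \<i>]; simp)+
qed

text \<open>A relation with an explicit witness in place of the description operator in
  \<open>adj\<close>. By nondegeneracy of \<open>ip\<close> it determines the adjoint and yields
  linearity, also over the algebra.\<close>

definition is_adjoint :: "('e \<Rightarrow> 'e \<Rightarrow> 'a) \<Rightarrow> ('e \<Rightarrow> 'e) \<Rightarrow> ('e \<Rightarrow> 'e) \<Rightarrow> bool" where
  "is_adjoint ip T T' \<longleftrightarrow> (\<forall>x y. ip (T x) y = ip x (T' y))"

lemma is_adjointD: "is_adjoint ip T T' \<Longrightarrow> ip (T x) y = ip x (T' y)"
  by (simp add: is_adjoint_def)

context hilbert_module
begin

section \<open>Inner product calculus and the Cauchy-Schwarz inequality\<close>

lemma ip_zero_right [simp]: "ip x 0 = 0"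
  using ip_add_right[of x 0 0] by simp

lemma ip_minus_right: "ip x (- y) = - ip x y"
  using ip_add_right[of x y "-y"] by (simp add: eq_neg_iff_add_eq_0 add.commute)

lemma ip_diff_right: "ip x (y - z) = ip x y - ip x z"
  using ip_add_right[of x y "-z"] by (simp add: ip_minus_right)

lemma ip_scaleR_right: "ip x (r *\<^sub>R y) = r *\<^sub>R ip x y"
  by (simp add: scaleR_scaleC ip_scaleC_right)

lemma ip_add_left: "ip (x + y) z = ip x z + ip y z"
  by (metis ip_star ip_add_right star_add)

lemma ip_scaleC_left: "ip (c *\<^sub>C x) y = cnj c *\<^sub>C ip x y"
  by (metis ip_star ip_scaleC_right star_scaleC)

lemma ip_zero_left [simp]: "ip 0 x = 0"
  using ip_add_left[of 0 0 x] by simp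

lemma ip_minus_left: "ip (- x) y = - ip x y"
  by (metis ip_star ip_minus_right star_minus)

lemma ip_diff_left: "ip (x - y) z = ip x z - ip y z"
  by (metis ip_star ip_diff_right star_diff)

lemma ip_scaleR_left: "ip (r *\<^sub>R x) y = r *\<^sub>R ip x y"
  by (metis ip_star ip_scaleR_right star_scaleR)

lemma ip_act_left: "ip (act x a) y = star a * ip x y"
  by (metis ip_star ip_act_right star_mult)

lemmas ip_linear = ip_add_left ip_add_right ip_diff_left ip_diff_right ip_minus_left ip_minus_right
  ip_scaleR_left ip_scaleR_right ip_zero_left ip_zero_right

lemma norm_ip_self: "norm (ip x x) = (norm x)\<^sup>2"
  by (simp add: norm_eq)

lemma ip_ext: "(\<And>z. ip z x = ip z y) \<Longrightarrow> x = y"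
  using ip_definite[of "x - y"] by (simp add: ip_diff_right)

text \<open>Expanding the square of t y - x a with a = <x, y> leaves the term
  \<open>star a * ip x x * a\<close>, which is at most t \<open>star a * a\<close> for t = (norm
  x)^2. What remains is t \<open>star a * a\<close> <= t^2 <y, y>.\<close>

lemma norm_ip_le: "norm (ip x y) \<le> norm x * norm y"
proof (cases "x = 0")
  case False
  define t a where "t = (norm x)\<^sup>2" and "a = ip x y"
  have t: "t > 0" using False by (simp add: t_def)
  have sa: "star a = ip y x" by (simp add: a_def ip_star)
  have "cstar_positive (t *\<^sub>R 1 - ip x x)"
    by (rule positive_scalar_minus) (simp_all add: ip_star norm_ip_self t_def)
  then have "cstar_positive (star a * (t *\<^sub>R 1 - ip x x) * a)" by (rule positive_conj)
  moreover have "cstar_positive (ip (t *\<^sub>R y - act x a) (t *\<^sub>R y - act x a))" by (rule ip_positive)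
  ultimately have "cstar_positive (star a * (t *\<^sub>R 1 - ip x x) * a + ip (t *\<^sub>R y - act x a) (t *\<^sub>R y - act x a))"
    by (rule positive_add)
  also have "star a * (t *\<^sub>R 1 - ip x x) * a + ip (t *\<^sub>R y - act x a) (t *\<^sub>R y - act x a)
     = (t * t) *\<^sub>R ip y y - t *\<^sub>R (star a * a)"
    by (simp add: ip_linear ip_act_left ip_act_right sa algebra_simps flip: a_def)
  finally have "norm (t *\<^sub>R (star a * a)) \<le> norm ((t * t) *\<^sub>R ip y y)"
    using t by (intro norm_mono_positive positive_scaleR positive_star_mult) simp_all
  then have "t * (norm a)\<^sup>2 \<le> t * (t * (norm y)\<^sup>2)"
    using t by (simp add: norm_star_mult norm_ip_self mult.assoc)
  then have "(norm a)\<^sup>2 \<le> t * (norm y)\<^sup>2" using t by simp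
  then have "(norm a)\<^sup>2 \<le> (norm x * norm y)\<^sup>2" by (simp add: t_def power_mult_distrib)
  then show ?thesis unfolding a_def by (rule power2_le_imp_le) simp
qed simp

section \<open>Adjoints and their boundedness\<close>

lemma is_adjoint_sym: "is_adjoint ip T T' \<Longrightarrow> is_adjoint ip T' T"
  unfolding is_adjoint_def by (metis ip_star)

lemma adjoint_scaleC_add: "is_adjoint ip T T' \<Longrightarrow> T (c *\<^sub>C x + y) = c *\<^sub>C T x + T y"
  by (rule ip_ext) (simp add: is_adjointD[OF is_adjoint_sym, symmetric] ip_add_right ip_scaleC_right)

lemma adjoint_add: "is_adjoint ip T T' \<Longrightarrow> T (x + y) = T x + T y"
  using adjoint_scaleC_add[of T T' 1 x y] by simp

lemma adjoint_scaleC: "is_adjoint ip T T' \<Longrightarrow> T (c *\<^sub>C x) = c *\<^sub>C T x"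
  by (rule ip_ext) (simp add: is_adjointD[OF is_adjoint_sym, symmetric] ip_scaleC_right)

lemma adjoint_scaleR: "is_adjoint ip T T' \<Longrightarrow> T (r *\<^sub>R x) = r *\<^sub>R T x"
  by (simp add: scaleR_scaleC adjoint_scaleC)

lemma adjoint_minus: "is_adjoint ip T T' \<Longrightarrow> T (- x) = - T x"
  using adjoint_scaleR[of T T' "-1" x] by simp

lemma adjoint_diff: "is_adjoint ip T T' \<Longrightarrow> T (x - y) = T x - T y"
  using adjoint_add[of T T' x "-y"] by (simp add: adjoint_minus)

lemma adjoint_act: "is_adjoint ip T T' \<Longrightarrow> T (act x a) = act (T x) a"
  by (rule ip_ext) (simp add: is_adjointD[OF is_adjoint_sym, symmetric] ip_act_right)

lemma adj_eq: "is_adjoint ip T T' \<Longrightarrow> adj ip T = T'"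
  unfolding adj_def is_adjoint_def
proof (rule the_equality)
  fix T'' assume "\<forall>x y. ip (T x) y = ip x (T' y)" "\<forall>x y. ip (T x) y = ip x (T'' y)"
  then show "T'' = T'" by (intro ext ip_ext) metis
qed simp

lemma adjointable_ops_iff: "T \<in> adjointable_ops ip \<longleftrightarrow> (\<exists>T'. is_adjoint ip T T')"
  unfolding adjointable_ops_def using adjoint_scaleC_add unfolding is_adjoint_def by blast

lemma continuous_ip_right: "continuous_on A (\<lambda>x. ip y x)"
proof -
  have "bounded_linear (\<lambda>x. ip y x)"
    by (rule bounded_linear_intro[of _ "norm y"])
      (simp_all add: ip_linear norm_ip_le mult.commute[of _ "norm y"])
  then show ?thesis by (rule linear_continuous_on)
qed

text \<open>Uniform boundedness: the sets \<open>B n\<close> below are closed because \<open>x \<mapsto> \<langle>T' y, x\<rangle>\<close> is continuous.\<close>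

lemma adjoint_bounded:
  assumes T: "is_adjoint ip T T'"
  obtains K where "K > 0" "\<And>x. norm (T x) \<le> K * norm x"
proof -
  define B where "B n = {x. \<forall>y. norm y \<le> 1 \<longrightarrow> norm (ip (T' y) x) \<le> real n}" for n
  have ipT: "ip (T' y) x = ip y (T x)" for x y using is_adjointD[OF is_adjoint_sym[OF T]] .
  have "B n = (\<Inter>y\<in>{y. norm y \<le> 1}. {x. norm (ip (T' y) x) \<le> real n})" for n by (auto simp: B_def)
  then have cl: "closed (B n)" for n
    by (auto intro!: closed_INT closed_Collect_le continuous_on_norm continuous_ip_right continuous_on_const)
  have "x \<in> B (nat \<lceil>norm (T x)\<rceil>)" for x
  proof -
    have "norm (ip (T' y) x) \<le> norm (T x)" if "norm y \<le> 1" for y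
      using norm_ip_le[of y "T x"] mult_right_mono[OF that norm_ge_zero[of "T x"]] by (simp add: ipT)
    then show ?thesis unfolding B_def using real_nat_ceiling_ge order_trans by blast
  qed
  then have UN: "\<Union> (range B) = UNIV" by blast
  have "\<exists>n. interior (B n) \<noteq> {}"
  proof (rule ccontr)
    assume "\<nexists>n. interior (B n) \<noteq> {}"
    then have "euclidean interior_of \<Union> (range B) = {}"
      using Met_TC.metric_Baire_category_alt[where 'a='e, of "range B"] cl complete_UNIV by auto
    then show False by (simp add: UN)
  qed
  then obtain n x0 \<epsilon> where \<epsilon>: "\<epsilon> > 0" "ball x0 \<epsilon> \<subseteq> B n" by (metis all_not_in_conv mem_interior)
  \<comment> \<open>Half the radius keeps x0 + u with norm u = d inside the open ball; the summand 1
    makes K positive even when n = 0.\<close>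
  define d K where "d = \<epsilon> / 2" and "K = 2 * real n / d + 1"
  have d: "d > 0" using \<epsilon> by (simp add: d_def)
  have Tn: "norm (T x) \<le> real n" if "x \<in> B n" for x
  proof (cases "T x = 0")
    case False
    let ?y = "(1 / norm (T x)) *\<^sub>R T x"
    have "norm ?y \<le> 1" using False by simp
    then have "norm (ip ?y (T x)) \<le> real n" using that unfolding B_def ipT by blast
    then show ?thesis using False by (simp add: ip_linear norm_ip_self power2_eq_square)
  qed simp
  have "norm (T x) \<le> K * norm x" for x
  proof (cases "x = 0")
    case True
    then show ?thesis using adjoint_scaleR[OF T, of 0 0] by simp
  next
    case False
    let ?u = "(d / norm x) *\<^sub>R x"
    have "x0 + ?u \<in> ball x0 \<epsilon>" "x0 \<in> ball x0 \<epsilon>" using False \<epsilon> d by (simp_all add: dist_norm d_def)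
    then have "norm (T (x0 + ?u)) \<le> n" "norm (T x0) \<le> n" using \<epsilon> Tn by blast+
    then have "norm (T (x0 + ?u) - T x0) \<le> 2 * real n" using norm_triangle_ineq4[of "T (x0 + ?u)" "T x0"] by linarith
    then have "(d / norm x) * norm (T x) \<le> 2 * real n"
      using d by (simp add: adjoint_add[OF T] adjoint_scaleR[OF T])
    then have "norm (T x) \<le> (2 * real n / d) * norm x" using d False by (simp add: field_simps)
    then show ?thesis by (simp add: K_def distrib_right add_increasing2)
  qed
  moreover have "K > 0" using d by (simp add: K_def add_nonneg_pos)
  ultimately show thesis using that by blast
qed

section \<open>From norm bounds to inequalities of forms\<close>

lemma ip_le_of_norm_le:
  assumes T: "is_adjoint ip T T'" and U: "is_adjoint ip U U'"
    and le: "\<And>x. norm (T x) \<le> norm (U x)"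
  shows "cstar_positive (ip (U x) (U x) - ip (T x) (T x))"
proof (rule le_of_norm_conj_le)
  fix h :: 'a assume h: "star h = h"
  \<comment> \<open>Adjointable maps commute with the action, so conjugating the form by h amounts
    to moving from x to x h.\<close>
  have "h * ip (W x) (W x) * h = ip (W (act x h)) (W (act x h))" if "is_adjoint ip W W'" for W W'
    using h by (simp add: adjoint_act[OF that] ip_act_left ip_act_right mult.assoc)
  then show "norm (h * ip (T x) (T x) * h) \<le> norm (h * ip (U x) (U x) * h)"
    using le T U by (simp add: norm_ip_self power_mono)
qed (simp_all add: ip_positive ip_star)

lemma is_adjoint_scaleR: "is_adjoint ip (\<lambda>x. r *\<^sub>R x) (\<lambda>x. r *\<^sub>R x)"
  by (simp add: is_adjoint_def ip_linear)

lemma ip_le_of_norm_bound: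
  assumes T: "is_adjoint ip T T'" and K: "0 \<le> K" "\<And>x. norm (T x) \<le> K * norm x"
  shows "cstar_positive (K\<^sup>2 *\<^sub>R ip x x - ip (T x) (T x))"
proof -
  have "cstar_positive (ip (K *\<^sub>R x) (K *\<^sub>R x) - ip (T x) (T x))"
    using T is_adjoint_scaleR by (rule ip_le_of_norm_le) (use K in simp)
  then show ?thesis by (simp add: ip_linear power2_eq_square)
qed

text \<open>As operators, (K - Q)^2 + (K^2 - Q^2) = 2 K (K - Q), and both summands on the left have
  nonnegative forms.\<close>

lemma form_le_of_norm_bound:
  assumes Q: "is_adjoint ip Q Q" and K: "0 < K" "\<And>x. norm (Q x) \<le> K * norm x"
  shows "cstar_positive (K *\<^sub>R ip x x - ip x (Q x))"
proof -
  have "cstar_positive ((1 / (K + K)) *\<^sub>R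
      (ip (K *\<^sub>R x - Q x) (K *\<^sub>R x - Q x) + (K\<^sup>2 *\<^sub>R ip x x - ip (Q x) (Q x))))"
    using K by (intro positive_scaleR positive_add ip_positive ip_le_of_norm_bound[OF Q]) auto
  moreover have "ip (K *\<^sub>R x - Q x) (K *\<^sub>R x - Q x) + (K\<^sup>2 *\<^sub>R ip x x - ip (Q x) (Q x))
      = (K + K) *\<^sub>R (K *\<^sub>R ip x x - ip x (Q x))"
    by (simp only: scaleR_add_left) (simp add: ip_linear is_adjointD[OF Q] algebra_simps power2_eq_square)
  ultimately show ?thesis using K by simp
qed

text \<open>Lax--Milgram: \<open>x \<mapsto> x - \<tau> (G x - y)\<close> is a contraction for small \<open>\<tau> > 0\<close>.\<close>

lemma coercive_bij:
  assumes G: "is_adjoint ip G G'" and \<delta>: "\<delta> > 0"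
    and pos: "\<And>x. cstar_positive (ip x (G x) + ip (G x) x - \<delta> *\<^sub>R ip x x)"
  shows "bij G"
proof -
  obtain K0 where K0: "\<And>x. norm (G x) \<le> K0 * norm x" using adjoint_bounded[OF G] by metis
  \<comment> \<open>Enlarging the bound to at least delta makes K positive and delta / K <= 1, which
    keeps kappa nonnegative.\<close>
  define K where "K = max K0 \<delta>"
  have K: "K \<ge> \<delta>" "norm (G x) \<le> K * norm x" for x
    using K0[of x] mult_right_mono[of K0 K "norm x"] by (auto simp: K_def)
  \<comment> \<open>The minimiser of 1 - tau delta + tau^2 K^2, which bounds the squared contraction
    factor; the minimum is 1 - (delta / K)^2 / 4.\<close>
  define \<tau> where "\<tau> = \<delta> / (2 * K\<^sup>2)"
  define \<kappa> where "\<kappa> = 1 - \<tau> * \<delta> + \<tau>\<^sup>2 * K\<^sup>2"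
  have \<tau>: "\<tau> > 0" using \<delta> K by (simp add: \<tau>_def)
  have "\<kappa> = 1 - (\<delta> / K)\<^sup>2 / 4" using \<delta> K(1) by (simp add: \<kappa>_def \<tau>_def field_simps power2_eq_square)
  moreover have "0 < (\<delta> / K)\<^sup>2" "(\<delta> / K)\<^sup>2 \<le> 1" using \<delta> K(1) by (simp_all add: power_le_one)
  ultimately have \<kappa>: "0 \<le> \<kappa>" "\<kappa> < 1" by linarith+
  have contr: "norm (u - \<tau> *\<^sub>R G u) \<le> sqrt \<kappa> * norm u" for u
  proof -
    have "cstar_positive (\<tau> *\<^sub>R (ip u (G u) + ip (G u) u - \<delta> *\<^sub>R ip u u)
        + (\<tau>\<^sup>2) *\<^sub>R (K\<^sup>2 *\<^sub>R ip u u - ip (G u) (G u)))"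
      using \<tau> K \<delta> by (intro positive_add positive_scaleR pos ip_le_of_norm_bound[OF G]) auto
    moreover have "\<kappa> *\<^sub>R ip u u - ip (u - \<tau> *\<^sub>R G u) (u - \<tau> *\<^sub>R G u)
      = \<tau> *\<^sub>R (ip u (G u) + ip (G u) u - \<delta> *\<^sub>R ip u u) + (\<tau>\<^sup>2) *\<^sub>R (K\<^sup>2 *\<^sub>R ip u u - ip (G u) (G u))"
      by (simp add: \<kappa>_def ip_linear algebra_simps power2_eq_square)
    ultimately have "norm (ip (u - \<tau> *\<^sub>R G u) (u - \<tau> *\<^sub>R G u)) \<le> norm (\<kappa> *\<^sub>R ip u u)"
      by (intro norm_mono_positive ip_positive) simp
    then have "(norm (u - \<tau> *\<^sub>R G u))\<^sup>2 \<le> (sqrt \<kappa> * norm u)\<^sup>2"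
      using \<kappa> by (simp add: norm_ip_self power_mult_distrib)
    then show ?thesis by (rule power2_le_imp_le) (use \<kappa> in simp)
  qed
  have "\<exists>!x. G x = y" for y
  proof -
    have "\<exists>!x. x - \<tau> *\<^sub>R (G x - y) = x"
    proof (rule contraction_fixpoint)
      show "sqrt \<kappa> < 1" using \<kappa> by simp
      show "norm ((x - \<tau> *\<^sub>R (G x - y)) - (x' - \<tau> *\<^sub>R (G x' - y))) \<le> sqrt \<kappa> * norm (x - x')" for x x'
        using contr[of "x - x'"] by (simp add: adjoint_diff[OF G] algebra_simps)
    qed
    then show ?thesis using \<tau> by simp
  qed
  then show ?thesis by (simp add: bij_iff)
qed

text \<open>Coercivity is symmetric in G and its adjoint, so both are bijective and
  \<open>inv G'\<close> is the adjoint of \<open>inv G\<close>. The inverse is thus adjointable, as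
  \<open>op_spectrum\<close> demands.\<close>

lemma coercive_inverse:
  assumes G: "is_adjoint ip G G'" and \<delta>: "\<delta> > 0"
    and pos: "\<And>x. cstar_positive (ip x (G x) + ip (G x) x - \<delta> *\<^sub>R ip x x)"
  obtains R R' where "is_adjoint ip R R'" "\<And>x. R (G x) = x" "\<And>x. G (R x) = x"
proof -
  note G' = is_adjoint_sym[OF G]
  have b: "bij G" by (rule coercive_bij[OF assms])
  have "cstar_positive (ip x (G' x) + ip (G' x) x - \<delta> *\<^sub>R ip x x)" for x
    using pos[of x] by (simp add: is_adjointD[OF G] is_adjointD[OF G'] add.commute)
  then have b': "bij G'" using G' \<delta> by (rule coercive_bij[rotated -1])
  have "is_adjoint ip (inv G) (inv G')"
    unfolding is_adjoint_def
  proof (intro allI)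
    fix x y
    have "ip (inv G x) y = ip (inv G x) (G' (inv G' y))" using b' by (simp add: bij_is_surj surj_f_inv_f)
    also have "\<dots> = ip (G (inv G x)) (inv G' y)" by (simp add: is_adjointD[OF G])
    finally show "ip (inv G x) y = ip x (inv G' y)" using b by (simp add: bij_is_surj surj_f_inv_f)
  qed
  then show thesis by (rule that) (use b in \<open>simp_all add: bij_is_surj bij_is_inj surj_f_inv_f\<close>)
qed

text \<open>For z off the half-line, G = theta (z - P) has twice the real part of its form equal to
  2 Re (theta z) <x, x> - 2 Re theta <x, P x>. The second term only helps, so G is coercive and z -
  P is invertible.\<close>

lemma op_positiveI:
  assumes P: "is_adjoint ip P P" and pos: "\<And>x. cstar_positive (ip x (P x))"
  shows "op_positive ip P"
  unfolding op_positive_def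
proof (intro conjI subsetI)
  show "P \<in> adjointable_ops ip" using P adjointable_ops_iff by blast
  show "adj ip P = P" by (rule adj_eq[OF P])
  fix z assume z: "z \<in> op_spectrum ip P"
  show "z \<in> \<real>\<^sub>\<ge>\<^sub>0"
  proof (rule ccontr)
    assume "z \<notin> \<real>\<^sub>\<ge>\<^sub>0"
    then obtain \<theta> where \<theta>: "Re \<theta> \<le> 0" "Re (\<theta> * z) > 0" by (rule not_nonneg_Reals_rotate)
    then have \<theta>0: "\<theta> \<noteq> 0" by auto
    define G where "G x = \<theta> *\<^sub>C (z *\<^sub>C x - P x)" for x
    have G: "is_adjoint ip G (\<lambda>x. cnj \<theta> *\<^sub>C (cnj z *\<^sub>C x - P x))"
      by (simp add: is_adjoint_def G_def ip_scaleC_left ip_scaleC_right ip_diff_left ip_diff_right is_adjointD[OF P])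
    have re: "w *\<^sub>C a + cnj w *\<^sub>C a = (2 * Re w) *\<^sub>R a" for w and a :: 'a
      by (simp add: complex_add_cnj scaleR_scaleC flip: scaleC_add_left)
    have "ip x (G x) + ip (G x) x
        = ((\<theta> * z) *\<^sub>C ip x x + cnj (\<theta> * z) *\<^sub>C ip x x) - (\<theta> *\<^sub>C ip x (P x) + cnj \<theta> *\<^sub>C ip x (P x))" for x
      by (simp add: G_def ip_scaleC_left ip_scaleC_right ip_diff_left ip_diff_right is_adjointD[OF P]
          scaleC_diff_right scaleC_scaleC)
    then have f: "ip x (G x) + ip (G x) x - (2 * Re (\<theta> * z)) *\<^sub>R ip x x = (- 2 * Re \<theta>) *\<^sub>R ip x (P x)" for x
      unfolding re by simp
    have "cstar_positive (ip x (G x) + ip (G x) x - (2 * Re (\<theta> * z)) *\<^sub>R ip x x)" for x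
      unfolding f using \<theta> by (intro positive_scaleR pos) simp
    moreover have "2 * Re (\<theta> * z) > 0" using \<theta> by simp
    ultimately obtain R R' where R: "is_adjoint ip R R'" "\<And>x. R (G x) = x" "\<And>x. G (R x) = x"
      using coercive_inverse[OF G] by metis
    define W where "W x = R (\<theta> *\<^sub>C x)" for x
    have "is_adjoint ip W (\<lambda>x. cnj \<theta> *\<^sub>C R' x)"
      by (simp add: is_adjoint_def W_def is_adjointD[OF R(1)] ip_scaleC_left ip_scaleC_right)
    then have "W \<in> adjointable_ops ip" using adjointable_ops_iff by blast
    moreover have "W (z *\<^sub>C x - P x) = x" for x using R(2)[of x] by (simp add: W_def G_def)
    moreover have "z *\<^sub>C W x - P (W x) = x" for x
    proof -
      have "inverse \<theta> *\<^sub>C (\<theta> *\<^sub>C (z *\<^sub>C W x - P (W x))) = inverse \<theta> *\<^sub>C (\<theta> *\<^sub>C x)"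
        using R(3)[of "\<theta> *\<^sub>C x"] by (simp add: G_def W_def)
      then show ?thesis using \<theta>0 by (simp add: scaleC_scaleC)
    qed
    ultimately show False using z by (auto simp: op_spectrum_def fun_eq_iff)
  qed
qed

text \<open>If the form of an invertible \<open>G\<close> is nonnegative and \<open>G\<^sup>-\<^sup>1 \<le> r\<close>, then evaluating the form of \<open>G\<close>
  at \<open>x - r\<^sup>-\<^sup>1 G\<^sup>-\<^sup>1 x\<close> gives \<open>G \<ge> r\<^sup>-\<^sup>1\<close>.\<close>

lemma invertible_form_coercive:
  assumes G: "is_adjoint ip G G" and pos: "\<And>x. cstar_positive (ip x (G x))"
    and R: "\<And>x. R (G x) = x" "\<And>x. G (R x) = x"
  obtains t where "t > 0" "\<And>x. cstar_positive (ip x (G x) - t *\<^sub>R ip x x)"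
proof -
  have Ra: "is_adjoint ip R R" unfolding is_adjoint_def by (metis R is_adjointD[OF G])
  obtain r where r: "r > 0" "\<And>x. norm (R x) \<le> r * norm x" using adjoint_bounded[OF Ra] by metis
  have "cstar_positive (ip x (G x) - (1 / r) *\<^sub>R ip x x)" for x
  proof -
    define t where "t = 1 / r"
    have tr: "t * t * r = t" using r by (simp add: t_def)
    \<comment> \<open>The form of G here is <x, G x> - 2 t <x, x> + t^2 <x, R x>; bounding R by r
      and using t^2 r = t leaves <x, G x> - t <x, x>.\<close>
    let ?z = "x - t *\<^sub>R R x"
    have "cstar_positive (ip ?z (G ?z) + (t * t) *\<^sub>R (r *\<^sub>R ip x x - ip x (R x)))"
      using r by (intro positive_add pos positive_scaleR form_le_of_norm_bound Ra) auto
    moreover have "ip (R x) (G x) = ip x x" by (metis R(1) is_adjointD[OF Ra])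
    then have "ip ?z (G ?z) + (t * t) *\<^sub>R (r *\<^sub>R ip x x - ip x (R x)) = ip x (G x) - t *\<^sub>R ip x x"
      by (simp add: adjoint_diff[OF G] adjoint_scaleR[OF G] R ip_linear is_adjointD[OF Ra] scaleR_diff_right tr)
    ultimately show ?thesis by (simp add: t_def)
  qed
  then show thesis using r(1) that[of "1 / r"] by simp
qed

text \<open>Let s be the least nonnegative number for which the form of P + s is nonnegative. If s >
  0, then -s is outside the spectrum, so P + s is invertible, hence bounded below by some t > 0, and
  s could be lowered.\<close>

lemma op_positive_form:
  assumes P: "op_positive ip P"
  shows "cstar_positive (ip x (P x))"
proof -
  have Pa: "is_adjoint ip P P"
    using P adj_eq unfolding op_positive_def adjointable_ops_iff by metis
  \<comment> \<open>The condition 0 <= s bounds \<open>F\<close> below and makes s = 0 the value to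
    be reached.\<close>
  define F where "F = {s. 0 \<le> s \<and> (\<forall>x. cstar_positive (ip x (P x) + s *\<^sub>R ip x x))}"
  obtain K where K: "K > 0" "\<And>x. norm (P x) \<le> K * norm x" using adjoint_bounded[OF Pa] by metis
  have "is_adjoint ip (\<lambda>x. - P x) (\<lambda>x. - P x)" using Pa by (simp add: is_adjoint_def ip_linear)
  from form_le_of_norm_bound[OF this, of K] have "K \<in> F"
    using K by (simp add: F_def ip_linear add.commute)
  define s where "s = Inf F"
  have bd: "bdd_below F" by (rule bdd_belowI[of _ 0]) (simp add: F_def)
  have s0: "0 \<le> s" unfolding s_def by (rule cInf_greatest) (use \<open>K \<in> F\<close> in \<open>auto simp: F_def\<close>)
  have pos: "cstar_positive (ip x (P x) + s *\<^sub>R ip x x)" for x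
  proof (rule positive_closed[of "ip x x"])
    fix \<epsilon> :: real assume "\<epsilon> > 0"
    then obtain u where u: "u \<in> F" "u < s + \<epsilon>"
      using cInf_lessD[of F "s + \<epsilon>"] \<open>K \<in> F\<close> by (auto simp: s_def)
    have "cstar_positive ((ip x (P x) + u *\<^sub>R ip x x) + (s + \<epsilon> - u) *\<^sub>R ip x x)"
      by (rule positive_add[OF _ positive_scaleR[OF ip_positive]]) (use u in \<open>auto simp: F_def\<close>)
    then show "cstar_positive (ip x (P x) + s *\<^sub>R ip x x + \<epsilon> *\<^sub>R ip x x)"
      by (simp add: algebra_simps)
  qed (simp add: ip_star)
  have "s = 0"
  proof (rule ccontr)
    assume "s \<noteq> 0"
    then have "complex_of_real (- s) \<notin> op_spectrum ip P"
      using P s0 by (auto simp: op_positive_def complex_nonneg_Reals_iff subset_iff simp del: of_real_minus)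
    then obtain R where R: "R \<in> adjointable_ops ip" "R \<circ> (\<lambda>x. of_real (- s) *\<^sub>C x - P x) = id"
      "(\<lambda>x. of_real (- s) *\<^sub>C x - P x) \<circ> R = id" unfolding op_spectrum_def by blast
    obtain R' where R': "is_adjoint ip R R'" using R(1) adjointable_ops_iff by blast
    define G where "G x = P x + s *\<^sub>R x" for x
    have G: "is_adjoint ip G G" using Pa by (simp add: is_adjoint_def G_def ip_linear)
    have Gm: "- of_real s *\<^sub>C x - P x = - G x" for x by (simp add: G_def scaleR_scaleC scaleC_minus_left)
    have "- R (G x) = x" for x using fun_cong[OF R(2), of x] by (simp add: Gm adjoint_minus[OF R'])
    moreover have "G (- R x) = x" for x using fun_cong[OF R(3), of x] by (simp add: Gm adjoint_minus[OF G])
    moreover have "cstar_positive (ip x (G x))" for x using pos by (simp add: G_def ip_linear)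
    ultimately obtain t where t: "t > 0" "\<And>x. cstar_positive (ip x (G x) - t *\<^sub>R ip x x)"
      using invertible_form_coercive[OF G, of "\<lambda>x. - R x"] by metis
    \<comment> \<open>Truncated at 0 because s - t may be negative and then lies outside
      \<open>F\<close>.\<close>
    define u where "u = max 0 (s - t)"
    have "cstar_positive ((ip x (G x) - t *\<^sub>R ip x x) + (u - (s - t)) *\<^sub>R ip x x)" for x
      by (rule positive_add[OF t(2) positive_scaleR[OF ip_positive]]) (simp add: u_def)
    then have "u \<in> F" by (simp add: F_def u_def G_def ip_linear algebra_simps)
    then have "s \<le> u" unfolding s_def using bd by (rule cInf_lower)
    then show False using t(1) s0 \<open>s \<noteq> 0\<close> by (auto simp: u_def)
  qed
  then show ?thesis using pos[of x] by simp
qed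

end

section \<open>Conjugate automorphisms\<close>

context
  fixes sharp :: "'a::cstar_algebra \<Rightarrow> 'a"
  assumes sharp: "star_conj_automorphism sharp"
begin

lemma sharp_involution: "sharp (sharp a) = a"
  and sharp_star: "star (sharp a) = sharp (star a)"
  and sharp_mult: "sharp (a * b) = sharp a * sharp b"
  and sharp_scaleC_add: "sharp (c *\<^sub>C a + b) = cnj c *\<^sub>C sharp a + sharp b"
  using sharp by (simp_all add: star_conj_automorphism_def)

lemma sharp_one: "sharp 1 = 1"
  by (metis sharp_involution sharp_mult mult_1_left mult_1_right)

lemma sharp_scaleC_one_minus: "sharp (c *\<^sub>C 1 - a) = cnj c *\<^sub>C 1 - sharp a"
proof -
  have "sharp 0 = 0" using sharp_scaleC_add[of 1 0 0] by simp
  then have "sharp (- a) = - sharp a" using sharp_scaleC_add[of "-1" a 0] by (simp add: scaleC_minus_left)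
  then show ?thesis using sharp_scaleC_add[of c 1 "- a"] by (simp add: sharp_one)
qed

text \<open>\<open>sharp\<close> carries an inverse of z - a to one of cnj z - sharp a. Only real
  spectral points have to be tested, and conjugation fixes them.\<close>

lemma sharp_positive:
  assumes a: "cstar_positive a" shows "cstar_positive (sharp a)"
  unfolding positive_iff_spectrum
proof (intro conjI allI impI)
  show "star (sharp a) = sharp a" using a by (simp add: sharp_star positive_selfadjoint)
  fix t assume t: "complex_of_real t \<in> cstar_spectrum (sharp a)"
  have "complex_of_real t \<in> cstar_spectrum a"
  proof (rule ccontr)
    assume "complex_of_real t \<notin> cstar_spectrum a"
    then obtain b where "b * (of_real t *\<^sub>C 1 - a) = 1" "(of_real t *\<^sub>C 1 - a) * b = 1"
      unfolding not_in_cstar_spectrum unit_elt_def by blast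
    then have "sharp b * (of_real t *\<^sub>C 1 - sharp a) = 1" "(of_real t *\<^sub>C 1 - sharp a) * sharp b = 1"
      using sharp_mult[of b "of_real t *\<^sub>C 1 - a"] sharp_mult[of "of_real t *\<^sub>C 1 - a" b]
      by (simp_all add: sharp_one sharp_scaleC_one_minus)
    then show False using t unfolding in_cstar_spectrum unit_elt_def by blast
  qed
  then show "0 \<le> t" by (rule positive_spectrum[OF a])
qed

text \<open>The bound comes from order: \<open>sharp\<close> preserves the positivity of norm a - a.
  Positive elements suffice, since the module norm only sees <x, x>.\<close>

lemma norm_sharp_positive:
  assumes "cstar_positive a" shows "norm (sharp a) = norm a"
proof -
  have *: "norm (sharp a) \<le> norm a" if a: "cstar_positive a" for a
  proof (rule norm_le_iff_positive[OF sharp_positive[OF a]])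
    have "cstar_positive (norm a *\<^sub>R 1 - a)" using a by (intro positive_scalar_minus positive_selfadjoint) auto
    from sharp_positive[OF this] show "cstar_positive (norm a *\<^sub>R 1 - sharp a)"
      by (simp add: scaleR_scaleC sharp_scaleC_one_minus)
  qed simp
  show ?thesis using *[OF assms] *[OF sharp_positive[OF assms]] by (simp add: sharp_involution)
qed

end

theorem theorem4p5:
  fixes act :: "'e::{complex_normed_vector, banach} \<Rightarrow> 'a::cstar_algebra \<Rightarrow> 'e"
    and ip :: "'e \<Rightarrow> 'e \<Rightarrow> 'a"
    and sharp :: "'a \<Rightarrow> 'a"
    and C T S :: "'e \<Rightarrow> 'e"
  assumes "star_conj_automorphism sharp"
    and "hilbert_module act ip"
    and "sharp_conjugation ip sharp C"
    and "T \<in> adjointable_ops ip"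
    and "S \<in> adjointable_ops ip"
    and "orthogonally_complemented ip (closure (range T))"
  shows "op_le ip (C \<circ> adj ip S \<circ> S \<circ> C) (adj ip T \<circ> T)
     \<longleftrightarrow> (\<forall>x. norm (T x) \<ge> norm (S (C x)))"
proof -
  interpret hilbert_module act ip by fact
  obtain T' S' where T: "is_adjoint ip T T'" and S: "is_adjoint ip S S'"
    using assms(4,5) unfolding adjointable_ops_iff by blast
  have CC: "C (C x) = x" and Cip: "ip (C x) (C y) = sharp (ip x y)" for x y
    using assms(3) by (auto simp: sharp_conjugation_def fun_eq_iff)
  have normC: "norm (C x) = norm x" for x
    by (simp add: norm_eq Cip norm_sharp_positive[OF assms(1) ip_positive])
  define V V' where "V x = C (S (C x))" and "V' x = C (S' (C x))" for x
  have V: "is_adjoint ip V V'"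
    unfolding is_adjoint_def
  proof (intro allI)
    fix x y
    have "ip (V x) y = sharp (ip (S (C x)) (C y))" using Cip[of "S (C x)" "C y"] by (simp add: V_def CC)
    also have "\<dots> = sharp (ip (C x) (S' (C y)))" by (simp add: is_adjointD[OF S])
    also have "\<dots> = ip x (V' y)" using Cip[of "C x" "S' (C y)"] by (simp add: V'_def CC)
    finally show "ip (V x) y = ip x (V' y)" .
  qed
  have normV: "norm (V x) = norm (S (C x))" for x by (simp add: V_def normC)
  define P where "P x = T' (T x) - V' (V x)" for x
  have P: "is_adjoint ip P P"
    using is_adjointD[OF T] is_adjointD[OF V] is_adjointD[OF is_adjoint_sym[OF T]] is_adjointD[OF is_adjoint_sym[OF V]]
    by (simp add: is_adjoint_def P_def ip_diff_left ip_diff_right)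
  have form: "ip x (P x) = ip (T x) (T x) - ip (V x) (V x)" for x
    by (simp add: P_def ip_diff_right is_adjointD[OF T] is_adjointD[OF V])
  \<comment> \<open>The inner pair C C in \<open>V' (V x)\<close> cancels, which identifies the two
    operators.\<close>
  have "op_le ip (C \<circ> adj ip S \<circ> S \<circ> C) (adj ip T \<circ> T) \<longleftrightarrow> op_positive ip P"
    by (simp add: op_le_def adj_eq[OF T] adj_eq[OF S] P_def[abs_def] V_def V'_def CC)
  also have "\<dots> \<longleftrightarrow> (\<forall>x. norm (V x) \<le> norm (T x))"
  proof
    assume "op_positive ip P"
    then have "cstar_positive (ip (T x) (T x) - ip (V x) (V x))" for x
      using op_positive_form[of P x] by (simp add: form)
    then have "norm (ip (V x) (V x)) \<le> norm (ip (T x) (T x))" for x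
      by (intro norm_mono_positive ip_positive)
    then show "\<forall>x. norm (V x) \<le> norm (T x)" by (simp add: norm_ip_self)
  next
    assume "\<forall>x. norm (V x) \<le> norm (T x)"
    then show "op_positive ip P"
      by (intro op_positiveI P) (simp add: form ip_le_of_norm_le[OF V T])
  qed
  finally show ?thesis by (simp add: normV)
qed

end
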